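(* Let $f$ be $L$-smooth (not necessarily convex) and let $x_t$ denote the iterates generated by any of the algorithms AdaFW, AdaAFW, AdaPFW or AdaMP (described in the context); for AdaPFW assume that $\mathcal A$ is finite. If the algorithm generates an infinite sequence of iterates, then $$\lim_{t\to\infty}g(x_t)=0 .$$ Moreover, for every $t$ such that iterations $0,\dots,t$ are carried out and $N_{t+1}\ge1$, $$\min_{k=0,\dots,t}g(x_k)\le\frac{C_t}{\delta\sqrt{N_{t+1}}}=\mathcal O\Big(\frac1{\delta\sqrt t}\Big).$$ Here, for AdaFW, AdaAFW and AdaPFW, $g=g^{\mathrm{FW}}$ is the FW gap $g^{\mathrm{FW}}(x)=\max_{s\in\mathrm{conv}(\mathcal A)}\langle\nabla f(x),x-s\rangle$ and $C_t=\max\{2h_0,\;L_t^{\max}\,\mathrm{diam}(\mathcal A)^2\}$; for AdaMP, $g=g^{\mathrm{MP}}$ is the MP gap $g^{\mathrm{MP}}(x)=\max_{s\in\mathcal B}\langle\nabla f(x),s\rangle$ and $C_t=\mathrm{radius}(\mathcal A)\sqrt{2h_0\overline L_{t+1}}$.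
   Context: Setting. $\mathcal A\subset\mathbb R^p$ is a nonempty bounded (possibly infinite) set of "atoms", $\mathrm{conv}(\mathcal A)$ its convex hull, $\mathrm{lin}(\mathcal A)$ its linear span, $\mathcal B=\mathcal A\cup(-\mathcal A)$. $\|\cdot\|$ is the Euclidean norm, $\mathrm{diam}(\mathcal A)=\sup_{x,y\in\mathcal A}\|x-y\|$, $\mathrm{radius}(\mathcal A)=\sup_{a\in\mathcal A}\|a\|$. $f:\mathbb R^p\to\mathbb R$ is differentiable and $L$-smooth on the domain $D$, i.e. $\|\nabla f(x)-\nabla f(y)\|\le L\|x-y\|$ for all $x,y\in D$, where $L>0$, $D=\mathrm{conv}(\mathcal A)$ for the Frank-Wolfe (FW) variants AdaFW, AdaAFW, AdaPFW and $D=\mathrm{lin}(\mathcal A)$ for AdaMP. $h_t=f(x_t)-\min_{x\in D}f(x)$. Minima and maxima that are written are assumed to be attained. Algorithms. Inputs: $x_0\in\mathcal A$, $L_{-1}>0$, tolerance $\varepsilon\ge 0$, subproblem quality $\delta\in(0,1]$, parameters $\tau>1$, $0<\eta\le1$. At iteration $t=0,1,\dots$: compute a direction $d_t$ and a maximal step-size $\gamma_t^{\max}$ (depending on the variant, see below); set $g_t=\langle-\nabla f(x_t),d_t\rangle$; if $g_t\le\delta\varepsilon$, stop and return $x_t$. Otherwise choose any $M\in[\eta L_{t-1},L_{t-1}]$ and set $\gamma=\min\{g_t/(M\|d_t\|^2),\gamma_t^{\max}\}$; as long as the sufficient decrease condition $f(x_t+\gamma d_t)\le f(x_t)-\gamma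 g_t+\frac{\gamma^2M}{2}\|d_t\|^2$ fails, replace $M$ by $\tau M$ and recompute $\gamma=\min\{g_t/(M\|d_t\|^2),\gamma_t^{\max}\}$. When the condition holds, set $\gamma_t=\gamma$, $L_t=M$, $x_{t+1}=x_t+\gamma_td_t$. Directions. For the FW variants, $s_t\in\mathcal A$ is any atom with $\langle\nabla f(x_t),s_t-x_t\rangle\le\delta\min_{s\in\mathcal A}\langle\nabla f(x_t),s-x_t\rangle$. For AdaAFW and AdaPFW an active set $\mathcal S_t\subseteq\mathcal A$ and weights $\alpha_{v,t}>0$ ($v\in\mathcal S_t$, $\alpha_{v,t}=0$ otherwise) with $x_t=\sum_{v\in\mathcal S_t}\alpha_{v,t}v$, $\sum_v\alpha_{v,t}=1$, are maintained, starting from $\mathcal S_0=\{x_0\}$, $\alpha_{x_0,0}=1$; and $v_t\in\mathcal S_t$ is any element with $\langle\nabla f(x_t),x_t-v_t\rangle\le\delta\min_{v\in\mathcal S_t}\langle\nabla f(x_t),x_t-v\rangle$. - AdaFW: $d_t=s_t-x_t$, $\gamma_t^{\max}=1$. - AdaAFW: if $\langle\nabla f(x_t),s_t-x_t\rangle\le\langle\nabla f(x_t),x_t-v_t\rangle$ then $d_t=s_t-x_t$, $\gamma_t^{\max}=1$ (FW step); otherwise $d_t=x_t-v_t$, $\gamma_t^{\max}=\alpha_{v_t,t}/(1-\alpha_{v_t,t})$ (away step). After a FW step, $\mathcal S_{t+1}=\{s_t\}$ if $\gamma_t=1$, else $\mathcal S_{t+1}=\mathcal S_t\cup\{s_t\}$,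 with $\alpha_{v,t+1}=(1-\gamma_t)\alpha_{v,t}$ for $v\in\mathcal S_t\setminus\{s_t\}$ and $\alpha_{s_t,t+1}=(1-\gamma_t)\alpha_{s_t,t}+\gamma_t$. After an away step, $\mathcal S_{t+1}=\mathcal S_t\setminus\{v_t\}$ if $\gamma_t=\gamma_t^{\max}$, else $\mathcal S_{t+1}=\mathcal S_t$, with $\alpha_{v,t+1}=(1+\gamma_t)\alpha_{v,t}$ for $v\in\mathcal S_t\setminus\{v_t\}$ and $\alpha_{v_t,t+1}=(1+\gamma_t)\alpha_{v_t,t}-\gamma_t$. - AdaPFW: $d_t=s_t-v_t$, $\gamma_t^{\max}=\alpha_{v_t,t}$. Then $\alpha_{s_t,t+1}=\alpha_{s_t,t}+\gamma_t$, $\alpha_{v_t,t+1}=\alpha_{v_t,t}-\gamma_t$, other weights unchanged; $\mathcal S_{t+1}=(\mathcal S_t\setminus\{v_t\})\cup\{s_t\}$ if $\alpha_{v_t,t+1}=0$, else $\mathcal S_{t+1}=\mathcal S_t\cup\{s_t\}$. - AdaMP: $s_t\in\mathcal B$ is any element with $\langle\nabla f(x_t),s_t\rangle\le\delta\min_{s\in\mathcal B}\langle\nabla f(x_t),s\rangle$; $d_t=s_t$, $\gamma_t^{\max}=+\infty$. Good and bad steps. Step $k$ is bad if $\gamma_k=\gamma_k^{\max}$ and $\gamma_k^{\max}<1$; otherwise it is good. $N_{t+1}$ is the number of good steps among $k=0,\dots,t$; $L_t^{\max}$ is the maximum of $L_k$ over good steps $k\in\{0,\dots,t\}$; $\overline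 L_{t+1}$ is the average of $L_k$ over good steps $k\in\{0,\dots,t\}$ (for AdaMP every step is good). The symbol $\mathcal O(1/(\delta\sqrt t))$ hides constants independent of $t$ and $\delta$. *)

theory Defs
  imports "HOL-Analysis.Analysis"
begin

datatype variant = AdaFW | AdaAFW | AdaPFW | AdaMP

definition feasible_set :: "variant \<Rightarrow> (real ^ 'p) set \<Rightarrow> (real ^ 'p) set" where
  "feasible_set vr A = (if vr = AdaMP then span A else convex hull A)"

definition sym_atoms :: "(real ^ 'p) set \<Rightarrow> (real ^ 'p) set" where
  "sym_atoms A = A \<union> uminus ` A"

definition radius :: "(real ^ 'p) set \<Rightarrow> real" where
  "radius A = (SUP a\<in>A. norm a)"

(* In the gaps and in h, SUP and INF stand for a maximum and a minimum. The maxima are attained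
   at every iterate at which an iteration is carried out, because approx_argmin below requires
   the minimum of the linear subproblem to be attained. *)
definition fw_gap :: "(real ^ 'p) set \<Rightarrow> (real ^ 'p \<Rightarrow> real ^ 'p) \<Rightarrow> real ^ 'p \<Rightarrow> real" where
  "fw_gap A grad x = (SUP s\<in>convex hull A. grad x \<bullet> (x - s))"

definition mp_gap :: "(real ^ 'p) set \<Rightarrow> (real ^ 'p \<Rightarrow> real ^ 'p) \<Rightarrow> real ^ 'p \<Rightarrow> real" where
  "mp_gap A grad x = (SUP s\<in>sym_atoms A. grad x \<bullet> s)"

definition gap ::
  "variant \<Rightarrow> (real ^ 'p) set \<Rightarrow> (real ^ 'p \<Rightarrow> real ^ 'p) \<Rightarrow> real ^ 'p \<Rightarrow> real" where
  "gap vr A grad x = (if vr = AdaMP then mp_gap A grad x else fw_gap A grad x)"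

definition subopt ::
  "variant \<Rightarrow> (real ^ 'p) set \<Rightarrow> (real ^ 'p \<Rightarrow> real) \<Rightarrow> real ^ 'p \<Rightarrow> real" where
  "subopt vr A f x = f x - (INF y\<in>feasible_set vr A. f y)"

(* s is an element of S with phi s \<le> \<delta> * min phi(S), the minimum being attained at some m. *)
definition approx_argmin :: "real \<Rightarrow> 'a set \<Rightarrow> ('a \<Rightarrow> real) \<Rightarrow> 'a \<Rightarrow> bool" where
  "approx_argmin \<delta> S \<phi> s \<longleftrightarrow>
     s \<in> S \<and> (\<exists>m. is_arg_min \<phi> (\<lambda>a. a \<in> S) m \<and> \<phi> s \<le> \<delta> * \<phi> m)"

(* The history of a run. Entry t holds x_t, S_t, the weights alpha_{v,t}, s_t, v_t, d_t,
   gamma_t^max, gamma_t and L_t, in this order. The maximal step-size may be infinite.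
   Components a variant does not use are left unconstrained for that variant. *)
record ('p::finite) run =
  iter :: "nat \<Rightarrow> real ^ 'p"
  active :: "nat \<Rightarrow> (real ^ 'p) set"
  weight :: "nat \<Rightarrow> real ^ 'p \<Rightarrow> real"
  fw_atom :: "nat \<Rightarrow> real ^ 'p"
  away_atom :: "nat \<Rightarrow> real ^ 'p"
  direct :: "nat \<Rightarrow> real ^ 'p"
  step_max :: "nat \<Rightarrow> ereal"
  step_size :: "nat \<Rightarrow> real"
  lip_est :: "nat \<Rightarrow> real"

definition starts_at :: "real ^ 'p \<Rightarrow> 'p run \<Rightarrow> bool" where
  "starts_at x0 r \<longleftrightarrow>
     iter r 0 = x0 \<and> active r 0 = {x0} \<and> weight r 0 = (\<lambda>v. if v = x0 then 1 else 0)"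

definition fw_step_chosen :: "(real ^ 'p \<Rightarrow> real ^ 'p) \<Rightarrow> 'p run \<Rightarrow> nat \<Rightarrow> bool" where
  "fw_step_chosen grad r t \<longleftrightarrow>
     grad (iter r t) \<bullet> (fw_atom r t - iter r t) \<le> grad (iter r t) \<bullet> (iter r t - away_atom r t)"

definition fw_oracle ::
  "(real ^ 'p) set \<Rightarrow> (real ^ 'p \<Rightarrow> real ^ 'p) \<Rightarrow> real \<Rightarrow> 'p run \<Rightarrow> nat \<Rightarrow> bool" where
  "fw_oracle A grad \<delta> r t \<longleftrightarrow>
     approx_argmin \<delta> A (\<lambda>s. grad (iter r t) \<bullet> (s - iter r t)) (fw_atom r t)"

definition away_oracle :: "(real ^ 'p \<Rightarrow> real ^ 'p) \<Rightarrow> real \<Rightarrow> 'p run \<Rightarrow> nat \<Rightarrow> bool" where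
  "away_oracle grad \<delta> r t \<longleftrightarrow>
     approx_argmin \<delta> (active r t) (\<lambda>v. grad (iter r t) \<bullet> (iter r t - v)) (away_atom r t)"

definition mp_oracle ::
  "(real ^ 'p) set \<Rightarrow> (real ^ 'p \<Rightarrow> real ^ 'p) \<Rightarrow> real \<Rightarrow> 'p run \<Rightarrow> nat \<Rightarrow> bool" where
  "mp_oracle A grad \<delta> r t \<longleftrightarrow>
     approx_argmin \<delta> (sym_atoms A) (\<lambda>s. grad (iter r t) \<bullet> s) (fw_atom r t)"

(* The quotient in the away case is taken in ereal, so that it is \<infinity> when the weight is 1. *)
definition direction_rule ::
  "variant \<Rightarrow> (real ^ 'p) set \<Rightarrow> (real ^ 'p \<Rightarrow> real ^ 'p) \<Rightarrow> real \<Rightarrow> 'p run \<Rightarrow> nat \<Rightarrow> bool" where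
  "direction_rule vr A grad \<delta> r t \<longleftrightarrow>
     (case vr of
        AdaFW \<Rightarrow>
          fw_oracle A grad \<delta> r t \<and>
          direct r t = fw_atom r t - iter r t \<and> step_max r t = 1
      | AdaAFW \<Rightarrow>
          fw_oracle A grad \<delta> r t \<and> away_oracle grad \<delta> r t \<and>
          (if fw_step_chosen grad r t
           then direct r t = fw_atom r t - iter r t \<and> step_max r t = 1
           else direct r t = iter r t - away_atom r t \<and>
                step_max r t = ereal (weight r t (away_atom r t))
                                 / ereal (1 - weight r t (away_atom r t)))
      | AdaPFW \<Rightarrow>
          fw_oracle A grad \<delta> r t \<and> away_oracle grad \<delta> r t \<and>
          direct r t = fw_atom r t - away_atom r t \<and>
          step_max r t = ereal (weight r t (away_atom r t))
      | AdaMP \<Rightarrow>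
          mp_oracle A grad \<delta> r t \<and>
          direct r t = fw_atom r t \<and> step_max r t = \<infinity>)"

(* Since weights vanish outside the active set, one formula gives the new weights of all atoms. *)
definition active_update ::
  "variant \<Rightarrow> (real ^ 'p \<Rightarrow> real ^ 'p) \<Rightarrow> 'p run \<Rightarrow> nat \<Rightarrow> bool" where
  "active_update vr grad r t \<longleftrightarrow>
     (let S = active r t; S' = active r (Suc t); \<alpha> = weight r t; \<alpha>' = weight r (Suc t);
          s = fw_atom r t; v = away_atom r t; \<gamma> = step_size r t
      in case vr of
        AdaFW \<Rightarrow> True
      | AdaAFW \<Rightarrow>
          (if fw_step_chosen grad r t
           then S' = (if \<gamma> = 1 then {s} else S \<union> {s}) \<and>
                \<alpha>' = (\<lambda>a. if a = s then (1 - \<gamma>) * \<alpha> a + \<gamma> else (1 - \<gamma>) * \<alpha> a)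
           else S' = (if ereal \<gamma> = step_max r t then S - {v} else S) \<and>
                \<alpha>' = (\<lambda>a. if a = v then (1 + \<gamma>) * \<alpha> a - \<gamma> else (1 + \<gamma>) * \<alpha> a))
      | AdaPFW \<Rightarrow>
          \<alpha>' = \<alpha>(s := \<alpha> s + \<gamma>, v := \<alpha> v - \<gamma>) \<and>
          S' = (if \<alpha>' v = 0 then (S - {v}) \<union> {s} else S \<union> {s})
      | AdaMP \<Rightarrow> True)"

(* The minimum of a real number and an element of (0, \<infinity>], hence always finite. *)
definition trial_step :: "real \<Rightarrow> real ^ 'p \<Rightarrow> ereal \<Rightarrow> real \<Rightarrow> real" where
  "trial_step g d gmax M = real_of_ereal (min (ereal (g / (M * (norm d)\<^sup>2))) gmax)"

definition sufficient_decrease ::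
  "(real ^ 'p \<Rightarrow> real) \<Rightarrow> real ^ 'p \<Rightarrow> real \<Rightarrow> real ^ 'p \<Rightarrow> ereal \<Rightarrow> real \<Rightarrow> bool" where
  "sufficient_decrease f x g d gmax M \<longleftrightarrow>
     (let \<gamma> = trial_step g d gmax M
      in f (x + \<gamma> *\<^sub>R d) \<le> f x - \<gamma> * g + \<gamma>\<^sup>2 * M / 2 * (norm d)\<^sup>2)"

(* M is the first element of M0, \<tau> * M0, \<tau>^2 * M0, ... that passes the test. *)
definition backtracking ::
  "(real ^ 'p \<Rightarrow> real) \<Rightarrow> real \<Rightarrow> real \<Rightarrow> real \<Rightarrow> real ^ 'p \<Rightarrow> real \<Rightarrow> real ^ 'p \<Rightarrow> ereal
     \<Rightarrow> real \<Rightarrow> real \<Rightarrow> bool" where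
  "backtracking f \<tau> \<eta> Lprev x g d gmax M \<gamma> \<longleftrightarrow>
     (\<exists>M0 i. M0 \<in> {\<eta> * Lprev..Lprev} \<and> M = \<tau> ^ i * M0 \<and>
        sufficient_decrease f x g d gmax M \<and>
        (\<forall>j<i. \<not> sufficient_decrease f x g d gmax (\<tau> ^ j * M0)) \<and>
        \<gamma> = trial_step g d gmax M)"

(* Iteration t is carried out: it does not stop and produces the iterate t + 1.
   Linit is the initial estimate L_{-1}. *)
definition iteration ::
  "variant \<Rightarrow> (real ^ 'p) set \<Rightarrow> (real ^ 'p \<Rightarrow> real) \<Rightarrow> (real ^ 'p \<Rightarrow> real ^ 'p)
     \<Rightarrow> real \<Rightarrow> real \<Rightarrow> real \<Rightarrow> real \<Rightarrow> real \<Rightarrow> 'p run \<Rightarrow> nat \<Rightarrow> bool" where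
  "iteration vr A f grad Linit \<epsilon> \<tau> \<eta> \<delta> r t \<longleftrightarrow>
     (let x = iter r t; d = direct r t; g = (- grad x) \<bullet> d;
          Lprev = (case t of 0 \<Rightarrow> Linit | Suc k \<Rightarrow> lip_est r k)
      in direction_rule vr A grad \<delta> r t \<and>
         g > \<delta> * \<epsilon> \<and>
         backtracking f \<tau> \<eta> Lprev x g d (step_max r t) (lip_est r t) (step_size r t) \<and>
         iter r (Suc t) = x + step_size r t *\<^sub>R d \<and>
         active_update vr grad r t)"

definition bad_step :: "('p::finite) run \<Rightarrow> nat \<Rightarrow> bool" where
  "bad_step r k \<longleftrightarrow> ereal (step_size r k) = step_max r k \<and> step_max r k < 1"

definition good_steps :: "('p::finite) run \<Rightarrow> nat \<Rightarrow> nat set" where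
  "good_steps r t = {k \<in> {0..t}. \<not> bad_step r k}"

definition num_good :: "('p::finite) run \<Rightarrow> nat \<Rightarrow> nat" where
  "num_good r t = card (good_steps r t)"

definition lip_max :: "('p::finite) run \<Rightarrow> nat \<Rightarrow> real" where
  "lip_max r t = Max (lip_est r ` good_steps r t)"

definition lip_avg :: "('p::finite) run \<Rightarrow> nat \<Rightarrow> real" where
  "lip_avg r t = (\<Sum>k\<in>good_steps r t. lip_est r k) / real (num_good r t)"

definition rate_const ::
  "variant \<Rightarrow> (real ^ 'p) set \<Rightarrow> (real ^ 'p \<Rightarrow> real) \<Rightarrow> 'p run \<Rightarrow> nat \<Rightarrow> real" where
  "rate_const vr A f r t =
     (let h0 = subopt vr A f (iter r 0)
      in if vr = AdaMP then radius A * sqrt (2 * h0 * lip_avg r t)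
         else max (2 * h0) (lip_max r t * (diameter A)\<^sup>2))"

end

theory Submission
  imports Defs
begin

text \<open>All variants accept a step of length \<open>\<gamma>\<close> only if it decreases \<open>f\<close> by at least half of
  \<open>\<gamma>\<close> times the slope \<open>g\<close> along the direction (\<open>backtracking_outcome\<close>), and \<open>g\<close> is at least
  \<open>\<delta>\<close> times the gap (\<open>direction_sound\<close>). By smoothness an estimate of at least \<open>L\<close> is never rejected,
  so the estimates stay bounded (\<open>iteration_sound\<close>). A good step either minimises the accepted
  quadratic model, which yields a decrease of order \<open>g\<^sup>2\<close>, or has length at least one, which yields
  \<open>g / 2\<close> (\<open>good_step_decrease\<close>). The decreases sum to at most the initial suboptimality, which
  bounds the smallest gap in terms of the number of good steps (\<open>fw_rate\<close>, \<open>mp_rate\<close>).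

  To express this in terms of the number of all steps, the bad steps are counted
  (\<open>good_fraction\<close>). A bad away step removes an active atom, and atoms are added only by good steps,
  one at a time. A bad pairwise step moves the whole weight of one atom to another; through a run of
  such steps the weights are the push-forward of the initial weights along a self-map of the finite
  set of atoms, and since \<open>f\<close> decreases strictly no such map occurs twice
  (\<open>pairwise_bad_run_length\<close>).

  The rate only says that the gap is small infinitely often. Convergence needs an argument that also
  controls bad steps, whose decrease may be tiny. While the gap is at least \<open>c\<close>, the distance
  travelled is at most a multiple of the decrease of \<open>f\<close>, with a factor that depends on \<open>c\<close>. Since
  \<open>f\<close> converges along the run, late stretches between a large and a small gap are arbitrarily
  short, which the Lipschitz continuity of the gap forbids (\<open>gap_tendsto_zero\<close>).\<close>

section \<open>Smoothness and backtracking\<close>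

text \<open>The quadratic upper bound of an \<open>L\<close>-smooth function: along the segment, the derivative of
  the difference of the two sides is nonpositive by the Lipschitz bound and Cauchy-Schwarz.\<close>

lemma smooth_quadratic_bound:
  fixes f :: "'a::real_inner \<Rightarrow> real"
  assumes D: "convex D" and deriv: "\<And>x. x \<in> D \<Longrightarrow> GDERIV f x :> grad x"
    and lip: "L-lipschitz_on D grad" and x: "x \<in> D" and y: "x + d \<in> D"
  shows "f (x + d) \<le> f x + grad x \<bullet> d + L / 2 * (norm d)\<^sup>2"
proof -
  define \<phi> where "\<phi> s = f (x + s *\<^sub>R d) - s * (grad x \<bullet> d) - L / 2 * (norm d)\<^sup>2 * s\<^sup>2" for s
  have seg: "x + s *\<^sub>R d \<in> D" if "0 \<le> s" "s \<le> 1" for s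
  proof -
    have "(1 - s) *\<^sub>R x + s *\<^sub>R (x + d) \<in> D"
      using D x y that by (simp add: convex_alt)
    then show ?thesis by (simp add: algebra_simps)
  qed
  have "\<phi> 1 \<le> \<phi> 0"
  proof (rule DERIV_nonpos_imp_nonincreasing[of 0 1 \<phi>])
    fix s :: real assume s: "0 \<le> s" "s \<le> 1"
    define z where "z = x + s *\<^sub>R d"
    have z: "z \<in> D" using seg s by (simp add: z_def)
    have "(f has_derivative (\<lambda>h. h \<bullet> grad z)) (at z)"
      using deriv[OF z] by (simp add: gderiv_def)
    then have df: "(f has_derivative (\<lambda>h. h \<bullet> grad z)) (at (x + s *\<^sub>R d))"
      by (simp add: z_def)
    have "((\<lambda>s. x + s *\<^sub>R d) has_derivative (\<lambda>h. h *\<^sub>R d)) (at s)"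
      using has_derivative_add[OF has_derivative_const
          has_derivative_scaleR_left[OF has_derivative_ident], of x d "at s"] by simp
    from has_derivative_compose[OF this df]
    have "((\<lambda>s. f (x + s *\<^sub>R d)) has_derivative (\<lambda>h. (h *\<^sub>R d) \<bullet> grad z)) (at s)" .
    then have "((\<lambda>s. f (x + s *\<^sub>R d)) has_field_derivative (grad z \<bullet> d)) (at s)"
      unfolding has_field_derivative_def
      by (rule has_derivative_eq_rhs) (simp add: fun_eq_iff inner_commute[of d])
    then have "(\<phi> has_field_derivative (grad z \<bullet> d - grad x \<bullet> d - L * s * (norm d)\<^sup>2)) (at s)"
      unfolding \<phi>_def by (auto intro!: derivative_eq_intros simp: field_simps)
    moreover have "grad z \<bullet> d - grad x \<bullet> d \<le> L * s * (norm d)\<^sup>2"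
    proof -
      have "grad z \<bullet> d - grad x \<bullet> d = (grad z - grad x) \<bullet> d" by (simp add: inner_diff_left)
      also have "\<dots> \<le> norm (grad z - grad x) * norm d" by (rule norm_cauchy_schwarz)
      also have "norm (grad z - grad x) \<le> L * norm (z - x)"
        using lipschitz_on_normD[OF lip z x] .
      also have "norm (z - x) = s * norm d" using s by (simp add: z_def)
      finally show ?thesis by (simp add: mult_right_mono power2_eq_square mult.assoc)
    qed
    ultimately show "\<exists>y. (\<phi> has_real_derivative y) (at s) \<and> y \<le> 0"
      by (intro exI[of _ "grad z \<bullet> d - grad x \<bullet> d - L * s * (norm d)\<^sup>2"]) simp
  qed simp
  then show ?thesis by (simp add: \<phi>_def)
qed

lemma trial_step_eq_min:
  assumes "0 < gmax"
  shows "ereal (trial_step g d gmax M) = min (ereal (g / (M * (norm d)\<^sup>2))) gmax"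
  using assms by (cases gmax) (auto simp: trial_step_def min_def)

lemma trial_step_pos:
  assumes "0 < gmax" "0 < g" "0 < M" "d \<noteq> 0"
  shows "0 < trial_step g d gmax M"
proof -
  have "0 < ereal (trial_step g d gmax M)"
    unfolding trial_step_eq_min[OF assms(1)] using assms by simp
  then show ?thesis by simp
qed

text \<open>A rejected estimate lies below the true constant \<open>L\<close>, so the accepted estimate exceeds
  \<open>\<tau> * L\<close> only if the first trial value was accepted. Since the step never exceeds the minimiser
  \<open>g / (M * (norm d)\<^sup>2)\<close> of the accepted quadratic model, half of the linear decrease
  \<open>\<gamma> * g\<close> is kept.\<close>

lemma backtracking_outcome:
  assumes bt: "backtracking f \<tau> \<eta> Lprev x g d gmax M \<gamma>"
    and pos: "0 < Lprev" "0 < \<eta>" "1 < \<tau>" "0 < g" "d \<noteq> 0" "0 < gmax"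
    and safe: "\<And>M'. 0 < M' \<Longrightarrow> L \<le> M' \<Longrightarrow> sufficient_decrease f x g d gmax M'"
  shows "0 < M" "M \<le> max Lprev (\<tau> * L)" "0 < \<gamma>"
    "ereal \<gamma> = min (ereal (g / (M * (norm d)\<^sup>2))) gmax"
    "f (x + \<gamma> *\<^sub>R d) \<le> f x - \<gamma> * g / 2"
proof -
  obtain M0 i where M0: "M0 \<in> {\<eta> * Lprev..Lprev}" and M: "M = \<tau> ^ i * M0"
    and sd: "sufficient_decrease f x g d gmax M"
    and fails: "\<And>j. j < i \<Longrightarrow> \<not> sufficient_decrease f x g d gmax (\<tau> ^ j * M0)"
    and \<gamma>: "\<gamma> = trial_step g d gmax M"
    using bt unfolding backtracking_def by blast
  have "0 < \<eta> * Lprev" using pos by simp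
  then have M0_pos: "0 < M0" using M0 by auto
  then show M_pos: "0 < M" using M pos by simp
  show "M \<le> max Lprev (\<tau> * L)"
  proof (cases i)
    case 0
    then show ?thesis using M M0 by (simp add: le_max_iff_disj)
  next
    case (Suc j)
    have "\<not> L \<le> \<tau> ^ j * M0"
      using safe[of "\<tau> ^ j * M0"] fails[of j] Suc M0_pos pos by auto
    then have "\<tau> * (\<tau> ^ j * M0) \<le> \<tau> * L" using pos by (intro mult_left_mono) auto
    then show ?thesis using Suc M by (simp add: mult.assoc)
  qed
  show \<gamma>_pos: "0 < \<gamma>" using trial_step_pos pos M_pos \<gamma> by blast
  show eq: "ereal \<gamma> = min (ereal (g / (M * (norm d)\<^sup>2))) gmax"
    using trial_step_eq_min pos \<gamma> by blast
  then have "ereal \<gamma> \<le> ereal (g / (M * (norm d)\<^sup>2))" by simp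
  then have "\<gamma> \<le> g / (M * (norm d)\<^sup>2)" by simp
  then have "\<gamma> * (M * (norm d)\<^sup>2) \<le> g" using M_pos pos by (simp add: pos_le_divide_eq)
  then have "\<gamma> * (\<gamma> * (M * (norm d)\<^sup>2)) \<le> \<gamma> * g" using \<gamma>_pos by (simp add: mult_left_mono)
  moreover have "f (x + \<gamma> *\<^sub>R d) \<le> f x - \<gamma> * g + \<gamma>\<^sup>2 * M / 2 * (norm d)\<^sup>2"
    using sd unfolding sufficient_decrease_def Let_def \<gamma> .
  ultimately show "f (x + \<gamma> *\<^sub>R d) \<le> f x - \<gamma> * g / 2"
    by (simp add: power2_eq_square algebra_simps)
qed

lemma approx_argmin_le:
  assumes "approx_argmin \<delta> S \<phi> s" "0 \<le> \<delta>" "a \<in> S"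
  shows "\<phi> s \<le> \<delta> * \<phi> a"
proof -
  obtain m where m: "is_arg_min \<phi> (\<lambda>a. a \<in> S) m" "\<phi> s \<le> \<delta> * \<phi> m"
    using assms by (auto simp: approx_argmin_def)
  then have "\<phi> m \<le> \<phi> a" using assms by (auto simp: is_arg_min_def not_less)
  then show ?thesis using m(2) mult_left_mono[of "\<phi> m" "\<phi> a" \<delta>] assms(2) by linarith
qed

section \<open>Linear functions on a convex hull\<close>

lemma inner_ge_on_convex_hull:
  assumes "\<And>a. a \<in> A \<Longrightarrow> b \<le> w \<bullet> a" and "y \<in> convex hull A"
  shows "b \<le> w \<bullet> y"
proof -
  have "convex hull A \<subseteq> {y. b \<le> w \<bullet> y}"
    by (rule hull_minimal) (use assms convex_halfspace_ge in auto)
  then show ?thesis using assms by auto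
qed

text \<open>A ball around an atom with radius the diameter contains all atoms, hence their hull; then the
  same ball around any point of the hull does so as well.\<close>

lemma norm_diff_hull_le_diameter:
  fixes A :: "'a::real_normed_vector set"
  assumes "bounded A" "x \<in> convex hull A" "y \<in> convex hull A"
  shows "norm (x - y) \<le> diameter A"
proof -
  have 1: "norm (a - y) \<le> diameter A" if "a \<in> A" "y \<in> convex hull A" for a y
  proof -
    have "convex hull A \<subseteq> cball a (diameter A)"
      by (rule hull_minimal) (use assms(1) that(1) diameter_bounded_bound in auto)
    then show ?thesis using that by (auto simp: dist_norm)
  qed
  have "convex hull A \<subseteq> cball y (diameter A)"
    by (rule hull_minimal) (use 1[OF _ assms(3)] in \<open>auto simp: dist_norm norm_minus_commute\<close>)
  then show ?thesis using assms by (auto simp: dist_norm norm_minus_commute)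
qed

lemma bdd_above_inner_image:
  assumes "bounded S"
  shows "bdd_above ((\<lambda>s. w \<bullet> (x - s)) ` S)" "bdd_above ((\<lambda>s. w \<bullet> s) ` S)"
proof -
  obtain B where B: "\<And>s. s \<in> S \<Longrightarrow> norm s \<le> B" using assms by (auto simp: bounded_iff)
  have *: "\<bar>w \<bullet> s\<bar> \<le> norm w * B" if "s \<in> S" for s
    using Cauchy_Schwarz_ineq2[of w s] mult_left_mono[OF B[OF that], of "norm w"] by simp
  show "bdd_above ((\<lambda>s. w \<bullet> s) ` S)"
    by (rule bdd_aboveI[of _ "norm w * B"]) (use * in fastforce)
  show "bdd_above ((\<lambda>s. w \<bullet> (x - s)) ` S)"
    by (rule bdd_aboveI[of _ "w \<bullet> x + norm w * B"])
       (use * in \<open>fastforce simp: inner_diff_right\<close>)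
qed

section \<open>Weights on active atoms\<close>

text \<open>Positive weights exactly on the active set: dropping an atom then means that its weight
  reaches zero, which is what ties the size of the active set to the bad steps.\<close>

definition convex_rep ::
  "'a::real_vector set \<Rightarrow> 'a set \<Rightarrow> ('a \<Rightarrow> real) \<Rightarrow> 'a \<Rightarrow> bool" where
  "convex_rep A S \<alpha> x \<longleftrightarrow> finite S \<and> S \<subseteq> A \<and> (\<forall>v\<in>S. 0 < \<alpha> v) \<and> (\<forall>v. v \<notin> S \<longrightarrow> \<alpha> v = 0) \<and>
     sum \<alpha> S = 1 \<and> (\<Sum>v\<in>S. \<alpha> v *\<^sub>R v) = x"

lemma convex_rep_sums:
  assumes "convex_rep A S \<alpha> x" "finite T" "S \<subseteq> T"
  shows "sum \<alpha> T = 1" "(\<Sum>v\<in>T. \<alpha> v *\<^sub>R v) = x"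
proof -
  have "sum \<alpha> T = sum \<alpha> S" "(\<Sum>v\<in>T. \<alpha> v *\<^sub>R v) = (\<Sum>v\<in>S. \<alpha> v *\<^sub>R v)"
    by (intro sum.mono_neutral_right; use assms in \<open>auto simp: convex_rep_def\<close>)+
  then show "sum \<alpha> T = 1" "(\<Sum>v\<in>T. \<alpha> v *\<^sub>R v) = x" using assms by (auto simp: convex_rep_def)
qed

lemma convex_repI:
  assumes "finite T" "T \<subseteq> A" "S \<subseteq> T" "\<And>v. v \<in> S \<Longrightarrow> 0 < \<alpha> v" "\<And>v. v \<notin> S \<Longrightarrow> \<alpha> v = 0"
    and "sum \<alpha> T = 1" "(\<Sum>v\<in>T. \<alpha> v *\<^sub>R v) = x"
  shows "convex_rep A S \<alpha> x"
proof -
  have "sum \<alpha> T = sum \<alpha> S" "(\<Sum>v\<in>T. \<alpha> v *\<^sub>R v) = (\<Sum>v\<in>S. \<alpha> v *\<^sub>R v)"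
    by (intro sum.mono_neutral_right; use assms in auto)+
  then show ?thesis using assms by (auto simp: convex_rep_def intro: finite_subset)
qed

lemma convex_rep_in_hull:
  assumes "convex_rep A S \<alpha> x" shows "x \<in> convex hull A"
proof -
  have "(\<Sum>v\<in>S. \<alpha> v *\<^sub>R v) \<in> convex hull A"
    using assms by (intro convex_sum) (auto simp: convex_rep_def hull_inc less_imp_le)
  then show ?thesis using assms by (simp add: convex_rep_def)
qed

lemma convex_rep_in_hull_active:
  assumes "convex_rep A S \<alpha> x" shows "x \<in> convex hull S"
proof -
  have "convex_rep S S \<alpha> x" using assms by (auto simp: convex_rep_def)
  then show ?thesis by (rule convex_rep_in_hull)
qed

lemma convex_rep_weight_le_1:
  assumes "convex_rep A S \<alpha> x" "v \<in> S" shows "\<alpha> v \<le> 1"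
  using assms member_le_sum[of v S \<alpha>] by (auto simp: convex_rep_def less_imp_le)

text \<open>An away step is only taken from a point other than the away atom, so this lemma keeps the
  quotient that limits its length finite.\<close>

lemma convex_rep_weight_1:
  assumes "convex_rep A S \<alpha> x" "v \<in> S" "\<alpha> v = 1" shows "x = v"
proof -
  have fin: "finite S" and sm: "sum \<alpha> S = 1" and p: "\<And>a. a \<in> S \<Longrightarrow> 0 < \<alpha> a"
    and x: "(\<Sum>v\<in>S. \<alpha> v *\<^sub>R v) = x"
    using assms by (auto simp: convex_rep_def)
  have "sum \<alpha> (S - {v}) = 0" using sum.remove[OF fin assms(2), of \<alpha>] sm assms by simp
  then have "S - {v} = {}"
    using sum_pos[of "S - {v}" \<alpha>] fin p by fastforce
  then have "S = {v}" using assms by auto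
  then show ?thesis using x assms by simp
qed

text \<open>All weight updates rescale the old weights and correct them at the two atoms \<open>s\<close> and \<open>v\<close>.
  Sums run over a set \<open>T\<close> that contains the active sets before and after the update.\<close>

lemma convex_rep_reweight_sums:
  assumes "convex_rep A S \<alpha> x" "finite T" "S \<subseteq> T" "s \<in> T" "v \<in> T"
    and \<alpha>': "\<And>a. \<alpha>' a = c * \<alpha> a + (if a = s then b else 0) + (if a = v then e else 0)"
  shows "sum \<alpha>' T = c + b + e" "(\<Sum>a\<in>T. \<alpha>' a *\<^sub>R a) = c *\<^sub>R x + b *\<^sub>R s + e *\<^sub>R v"
proof -
  note sums = convex_rep_sums[OF assms(1-3)]
  show "sum \<alpha>' T = c + b + e"
    using assms sums by (simp add: \<alpha>' sum.distrib flip: sum_distrib_left)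
  have "(if P then (r::real) else 0) *\<^sub>R a = (if P then r *\<^sub>R a else 0)" for P r and a :: 'a by simp
  then show "(\<Sum>a\<in>T. \<alpha>' a *\<^sub>R a) = c *\<^sub>R x + b *\<^sub>R s + e *\<^sub>R v"
    using assms sums
    by (simp add: \<alpha>' sum.distrib scaleR_add_left flip: scaleR_scaleR scaleR_sum_right)
qed

lemma convex_rep_fw_step:
  assumes rep: "convex_rep A S \<alpha> x" and s: "s \<in> A" and \<gamma>: "0 < \<gamma>" "\<gamma> \<le> 1"
  shows "convex_rep A (if \<gamma> = 1 then {s} else S \<union> {s})
    (\<lambda>a. if a = s then (1 - \<gamma>) * \<alpha> a + \<gamma> else (1 - \<gamma>) * \<alpha> a) (x + \<gamma> *\<^sub>R (s - x))"
    (is "convex_rep A ?S ?\<alpha> _")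
proof (rule convex_repI)
  let ?T = "insert s S"
  have fin: "finite ?T" using rep by (simp add: convex_rep_def)
  then show "finite ?T" .
  show "?T \<subseteq> A" using rep s by (auto simp: convex_rep_def)
  have nn: "0 \<le> \<alpha> a" for a using rep by (cases "a \<in> S") (auto simp: convex_rep_def less_imp_le)
  show "?S \<subseteq> ?T" by auto
  show "0 < ?\<alpha> v" if "v \<in> ?S" for v
    using that rep \<gamma> nn[of s] by (auto simp: convex_rep_def add_nonneg_pos split: if_splits)
  show "?\<alpha> v = 0" if "v \<notin> ?S" for v
    using that rep \<gamma> by (auto simp: convex_rep_def split: if_splits)
  have form: "?\<alpha> a = (1 - \<gamma>) * \<alpha> a + (if a = s then \<gamma> else 0) + (if a = s then 0 else 0)" for a
    by simp
  note sums = convex_rep_reweight_sums[OF rep fin _ _ _ form]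
  show "sum ?\<alpha> ?T = 1" using sums(1) by auto
  show "(\<Sum>a\<in>?T. ?\<alpha> a *\<^sub>R a) = x + \<gamma> *\<^sub>R (s - x)"
    using sums(2) by (auto simp: algebra_simps)
qed

lemma convex_rep_away_step:
  assumes rep: "convex_rep A S \<alpha> x" and v: "v \<in> S" "\<alpha> v < 1"
    and \<gamma>: "0 < \<gamma>" "\<gamma> \<le> \<alpha> v / (1 - \<alpha> v)"
  shows "convex_rep A (if \<gamma> = \<alpha> v / (1 - \<alpha> v) then S - {v} else S)
    (\<lambda>a. if a = v then (1 + \<gamma>) * \<alpha> a - \<gamma> else (1 + \<gamma>) * \<alpha> a) (x + \<gamma> *\<^sub>R (x - v))"
    (is "convex_rep A ?S ?\<alpha> _")
proof (rule convex_repI)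
  show fin: "finite S" and "S \<subseteq> A" and "?S \<subseteq> S" using rep by (auto simp: convex_rep_def)
  have new: "(1 + \<gamma>) * \<alpha> v - \<gamma> = (1 - \<alpha> v) * (\<alpha> v / (1 - \<alpha> v) - \<gamma>)"
    using v by (simp add: field_simps)
  show "0 < ?\<alpha> a" if a: "a \<in> ?S" for a
  proof (cases "a = v")
    case True
    then have "\<gamma> < \<alpha> v / (1 - \<alpha> v)" using a \<gamma> v by (auto split: if_splits)
    then show ?thesis using True new v by simp
  next
    case False
    then show ?thesis using a rep \<gamma> by (auto simp: convex_rep_def split: if_splits)
  qed
  show "?\<alpha> a = 0" if a: "a \<notin> ?S" for a
  proof (cases "a = v")
    case True
    then have "\<gamma> = \<alpha> v / (1 - \<alpha> v)" using a v by (auto split: if_splits)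
    then show ?thesis using True new by simp
  next
    case False
    then show ?thesis using a rep by (auto simp: convex_rep_def split: if_splits)
  qed
  have form: "?\<alpha> a = (1 + \<gamma>) * \<alpha> a + (if a = v then - \<gamma> else 0) + (if a = v then 0 else 0)" for a
    by simp
  note sums = convex_rep_reweight_sums[OF rep fin _ _ _ form]
  show "sum ?\<alpha> S = 1" using sums(1) v by auto
  show "(\<Sum>a\<in>S. ?\<alpha> a *\<^sub>R a) = x + \<gamma> *\<^sub>R (x - v)"
    using sums(2) v by (auto simp: algebra_simps)
qed

lemma convex_rep_pairwise_step:
  fixes s v :: "'a::real_vector" and \<gamma> :: real and \<alpha> :: "'a \<Rightarrow> real"
  defines "\<alpha>' \<equiv> \<alpha>(s := \<alpha> s + \<gamma>, v := \<alpha> v - \<gamma>)"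
  assumes rep: "convex_rep A S \<alpha> x" and s: "s \<in> A" "s \<noteq> v" and v: "v \<in> S"
    and \<gamma>: "0 < \<gamma>" "\<gamma> \<le> \<alpha> v"
  shows "convex_rep A (if \<alpha>' v = 0 then (S - {v}) \<union> {s} else S \<union> {s}) \<alpha>' (x + \<gamma> *\<^sub>R (s - v))"
    (is "convex_rep A ?S _ _")
proof (rule convex_repI)
  let ?T = "insert s S"
  have fin: "finite ?T" using rep by (simp add: convex_rep_def)
  then show "finite ?T" .
  show "?T \<subseteq> A" using rep s by (auto simp: convex_rep_def)
  have nn: "0 \<le> \<alpha> a" for a using rep by (cases "a \<in> S") (auto simp: convex_rep_def less_imp_le)
  show "?S \<subseteq> ?T" by auto
  show "0 < \<alpha>' a" if "a \<in> ?S" for a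
  proof -
    consider "a = v" | "a = s" | "a \<noteq> v" "a \<noteq> s" by blast
    then show ?thesis
    proof cases
      case 1
      then show ?thesis using that \<gamma> s v by (auto simp: \<alpha>'_def split: if_splits)
    next
      case 2
      then show ?thesis using \<gamma> nn[of s] s by (simp add: \<alpha>'_def add_nonneg_pos)
    next
      case 3
      then have "a \<in> S" using that by (auto split: if_splits)
      then show ?thesis using 3 rep by (simp add: convex_rep_def \<alpha>'_def)
    qed
  qed
  show "\<alpha>' a = 0" if "a \<notin> ?S" for a
  proof (cases "a = v")
    case True
    then show ?thesis using that v by (auto split: if_splits)
  next
    case False
    then have "a \<noteq> s" "a \<notin> S" using that by (auto split: if_splits)
    then show ?thesis using False rep by (simp add: convex_rep_def \<alpha>'_def)
  qed
  have form: "\<alpha>' a = 1 * \<alpha> a + (if a = s then \<gamma> else 0) + (if a = v then - \<gamma> else 0)" for a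
    using s by (simp add: \<alpha>'_def)
  note sums = convex_rep_reweight_sums[OF rep fin _ _ _ form]
  show "sum \<alpha>' ?T = 1" using sums(1) v by auto
  show "(\<Sum>a\<in>?T. \<alpha>' a *\<^sub>R a) = x + \<gamma> *\<^sub>R (s - v)"
    using sums(2) v by (auto simp: algebra_simps)
qed

section \<open>Vanishing gaps along a descent\<close>

text \<open>A gap that stays large forces the movement of the iterates to be paid for by a decrease of
  the objective, and only a vanishing decrease is left at late times. Hence between a late time
  with a large gap and the next time with a small gap the iterates hardly move, which contradicts
  the Lipschitz continuity of the gap. This covers long runs of steps whose decrease
  has no uniform positive lower bound: that bound is required only infinitely often.\<close>

lemma gap_tendsto_zero:
  fixes x :: "nat \<Rightarrow> 'a::real_normed_vector" and F G :: "nat \<Rightarrow> real"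
  assumes below: "\<And>n. b \<le> F n" and anti: "\<And>n. F (Suc n) \<le> F n" and nn: "\<And>n. 0 \<le> G n"
    and move: "\<And>n. \<kappa> * G n * norm (x (Suc n) - x n) \<le> F n - F (Suc n)" and \<kappa>: "0 < \<kappa>"
    and lip: "\<And>n m. G n - G m \<le> C * norm (x n - x m)"
    and decr: "\<And>c. 0 < c \<Longrightarrow> \<exists>p>0. \<forall>N. \<exists>n\<ge>N. c \<le> G n \<longrightarrow> p \<le> F n - F (Suc n)"
  shows "G \<longlonglongrightarrow> 0"
proof (rule LIMSEQ_I)
  fix c :: real assume c: "0 < c"
  have dec: "decseq F" using anti by (simp add: decseq_Suc_iff)
  then obtain l where l: "F \<longlonglongrightarrow> l" using decseq_convergent[OF dec] below by metis
  have F_ge: "l \<le> F n" for n using decseq_ge[OF dec l] .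
  have late: "\<exists>N. \<forall>n\<ge>N. F n < l + e" if "0 < e" for e
    using order_tendstoD(2)[OF l, of "l + e"] that by (simp add: eventually_sequentially)
  have small: "\<exists>n\<ge>N. G n < c / 2" for N
  proof -
    obtain p where p: "0 < p" and pn: "\<And>N. \<exists>n\<ge>N. c / 2 \<le> G n \<longrightarrow> p \<le> F n - F (Suc n)"
      using decr[of "c / 2"] half_gt_zero[OF c] by blast
    obtain N' where N': "\<And>n. n \<ge> N' \<Longrightarrow> F n < l + p" using late[OF p] by blast
    obtain n where n: "n \<ge> max N N'" and pdec: "c / 2 \<le> G n \<longrightarrow> p \<le> F n - F (Suc n)"
      using pn[of "max N N'"] by blast
    have "F n - F (Suc n) < p" using N'[of n] n F_ge[of "Suc n"] by auto
    then have "G n < c / 2" using pdec by linarith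
    then show ?thesis using n by auto
  qed
  (* A remaining decrease below e buys less movement than the gap needs to fall by c / 2. *)
  define e where "e = \<kappa> * (c / 2) * (c / (2 * (\<bar>C\<bar> + 1)))"
  have e: "0 < e" using c \<kappa> by (simp add: e_def)
  obtain N where N: "\<And>n. n \<ge> N \<Longrightarrow> F n < l + e" using late[OF e] by blast
  show "\<exists>N. \<forall>n\<ge>N. norm (G n - 0) < c"
  proof (intro exI allI impI)
    fix n assume n: "n \<ge> N"
    define k where "k = (LEAST k. n \<le> k \<and> G k < c / 2)"
    have k: "n \<le> k" "G k < c / 2"
      using LeastI_ex[of "\<lambda>k. n \<le> k \<and> G k < c / 2"] small[of n] by (auto simp: k_def)
    have before: "c / 2 \<le> G j" if "n \<le> j" "j < k" for j
      using not_less_Least[of j "\<lambda>k. n \<le> k \<and> G k < c / 2"] that by (auto simp: k_def)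
    have moved: "\<kappa> * (c / 2) * norm (x j - x n) \<le> F n - F j" if "n \<le> j" "j \<le> k" for j
      using that
    proof (induction j rule: dec_induct)
      case base
      then show ?case by simp
    next
      case (step j)
      have "norm (x (Suc j) - x n) \<le> norm (x (Suc j) - x j) + norm (x j - x n)"
        using norm_triangle_ineq[of "x (Suc j) - x j" "x j - x n"] by simp
      then have "\<kappa> * (c / 2) * norm (x (Suc j) - x n)
          \<le> \<kappa> * (c / 2) * norm (x (Suc j) - x j) + \<kappa> * (c / 2) * norm (x j - x n)"
        using \<kappa> c by (simp add: mult_left_mono flip: distrib_left)
      also have "\<kappa> * (c / 2) * norm (x (Suc j) - x j) \<le> \<kappa> * G j * norm (x (Suc j) - x j)"
        using before[of j] step \<kappa> by (intro mult_right_mono mult_left_mono) auto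
      also have "\<dots> \<le> F j - F (Suc j)" by (rule move)
      finally show ?case using step by simp
    qed
    have "F n - F k < e" using N[OF n] F_ge[of k] by simp
    then have "\<kappa> * (c / 2) * norm (x k - x n) < e" using moved[of k] k by simp
    then have "norm (x k - x n) < c / (2 * (\<bar>C\<bar> + 1))"
      unfolding e_def using \<kappa> c by (subst (asm) mult_less_cancel_left_pos) auto
    then have "norm (x k - x n) * (2 * (\<bar>C\<bar> + 1)) < c"
      by (subst (asm) pos_less_divide_eq) auto
    then have "(\<bar>C\<bar> + 1) * norm (x k - x n) < c / 2" by (simp add: algebra_simps)
    moreover have "C * norm (x n - x k) \<le> (\<bar>C\<bar> + 1) * norm (x k - x n)"
      by (subst norm_minus_commute) (intro mult_right_mono, auto)
    ultimately have "G n < c" using lip[of n k] k by linarith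
    then show "norm (G n - 0) < c" using nn[of n] by simp
  qed
qed

section \<open>The two gaps\<close>

lemma fw_gap_le:
  assumes "A \<noteq> {}" and "\<And>a. a \<in> A \<Longrightarrow> grad x \<bullet> (x - a) \<le> b"
  shows "fw_gap A grad x \<le> b"
  unfolding fw_gap_def
proof (rule cSUP_least)
  show "convex hull A \<noteq> {}" using assms by simp
  fix s assume "s \<in> convex hull A"
  then have "grad x \<bullet> x - b \<le> grad x \<bullet> s"
    by (rule inner_ge_on_convex_hull[rotated]) (use assms(2) in \<open>force simp: inner_diff_right\<close>)
  then show "grad x \<bullet> (x - s) \<le> b" by (simp add: inner_diff_right)
qed

lemma fw_gap_ge:
  assumes "bounded A" "s \<in> convex hull A"
  shows "grad x \<bullet> (x - s) \<le> fw_gap A grad x"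
  unfolding fw_gap_def
  by (rule cSUP_upper[OF assms(2) bdd_above_inner_image(1)[OF bounded_convex_hull[OF assms(1)]]])

lemma mp_gap_le:
  assumes "A \<noteq> {}" and "\<And>a. a \<in> sym_atoms A \<Longrightarrow> grad x \<bullet> a \<le> b"
  shows "mp_gap A grad x \<le> b"
  unfolding mp_gap_def by (rule cSUP_least) (use assms in \<open>auto simp: sym_atoms_def\<close>)

lemma uminus_sym_atoms: "s \<in> sym_atoms A \<Longrightarrow> - s \<in> sym_atoms A"
  by (auto simp: sym_atoms_def)

lemma mp_gap_ge:
  assumes "bounded A" "s \<in> sym_atoms A"
  shows "grad x \<bullet> s \<le> mp_gap A grad x"
proof -
  have "bounded (sym_atoms A)"
    using assms bounded_uminus[of A] by (simp add: sym_atoms_def)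
  then show ?thesis
    unfolding mp_gap_def using assms bdd_above_inner_image by (intro cSUP_upper) auto
qed

lemma norm_sym_atom_le_radius:
  assumes "bounded A" "s \<in> sym_atoms A"
  shows "norm s \<le> radius A"
proof -
  obtain B where "\<And>a. a \<in> A \<Longrightarrow> norm a \<le> B" using assms(1) by (auto simp: bounded_iff)
  then have bdd: "bdd_above (norm ` A)" by (auto intro!: bdd_aboveI2[of _ norm B])
  have "norm a \<le> radius A" if "a \<in> A" for a
    unfolding radius_def by (rule cSUP_upper[OF that bdd])
  then show ?thesis using assms by (auto simp: sym_atoms_def)
qed

section \<open>Invariants of a run\<close>

text \<open>All four variants are analysed together: once \<open>direction_sound\<close> and \<open>iteration_sound\<close> are
  known, their differences matter only for counting good steps and for the final constants.\<close>

locale adaptive_run =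
  fixes A :: "(real ^ 'p::finite) set"
    and f :: "real ^ 'p \<Rightarrow> real"
    and grad :: "real ^ 'p \<Rightarrow> real ^ 'p"
    and vr :: variant
    and x0 :: "real ^ 'p"
    and L Linit \<epsilon> \<tau> \<eta> \<delta> :: real
    and r :: "'p run"
  assumes bounded_atoms: "bounded A"
    and pairwise_finite: "vr = AdaPFW \<Longrightarrow> finite A"
    and deriv: "\<And>x. GDERIV f x :> grad x"
    and L_pos: "L > 0" and lip: "L-lipschitz_on (feasible_set vr A) grad"
    and min_attained: "\<exists>z. is_arg_min f (\<lambda>x. x \<in> feasible_set vr A) z"
    and x0_atom: "x0 \<in> A"
    and params: "Linit > 0" "\<epsilon> \<ge> 0" "\<tau> > 1" "0 < \<eta>" "0 < \<delta>"
    and start: "starts_at x0 r"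
begin

abbreviation "D \<equiv> feasible_set vr A"
abbreviation "X \<equiv> iter r"
abbreviation "carried_out \<equiv> iteration vr A f grad Linit \<epsilon> \<tau> \<eta> \<delta> r"
abbreviation "slope k \<equiv> (- grad (X k)) \<bullet> direct r k"
abbreviation "G k \<equiv> gap vr A grad (X k)"
abbreviation "M \<equiv> lip_est r"

text \<open>The length of every direction stays below this bound, whose square enters both rate
  constants.\<close>

definition direction_bound :: real where
  "direction_bound = (if vr = AdaMP then radius A else diameter A)"

definition lip_bound :: real where
  "lip_bound = max Linit (\<tau> * L)"

definition prev_est :: "nat \<Rightarrow> real" where
  "prev_est k = (case k of 0 \<Rightarrow> Linit | Suc k \<Rightarrow> M k)"

definition tracks_weights :: "nat \<Rightarrow> bool" where
  "tracks_weights k \<longleftrightarrow>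
     (vr = AdaAFW \<or> vr = AdaPFW \<longrightarrow> convex_rep A (active r k) (weight r k) (X k))"

definition sound_state :: "nat \<Rightarrow> bool" where
  "sound_state k \<longleftrightarrow> X k \<in> D \<and> tracks_weights k \<and> 0 < prev_est k \<and> prev_est k \<le> lip_bound"

lemma atoms_nonempty: "A \<noteq> {}"
  using x0_atom by auto

lemma convex_D: "convex D"
  by (simp add: feasible_set_def convex_convex_hull subspace_imp_convex subspace_span)

lemma min_le: "x \<in> D \<Longrightarrow> (INF y\<in>D. f y) \<le> f x"
proof -
  obtain z where "is_arg_min f (\<lambda>x. x \<in> D) z" using min_attained by blast
  then have "bdd_below (f ` D)" by (auto intro!: bdd_belowI2[of _ "f z"] simp: is_arg_min_def not_less)
  then show "x \<in> D \<Longrightarrow> (INF y\<in>D. f y) \<le> f x" by (rule cINF_lower)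
qed

lemma gap_nonneg:
  assumes "x \<in> D" shows "0 \<le> gap vr A grad x"
proof (cases "vr = AdaMP")
  case True
  have "x0 \<in> sym_atoms A" using x0_atom by (simp add: sym_atoms_def)
  then have "grad x \<bullet> x0 \<le> mp_gap A grad x" "grad x \<bullet> (- x0) \<le> mp_gap A grad x"
    using mp_gap_ge bounded_atoms uminus_sym_atoms by blast+
  then show ?thesis using True by (simp add: gap_def)
next
  case False
  then show ?thesis
    using fw_gap_ge[OF bounded_atoms, of x grad x] assms by (simp add: gap_def feasible_set_def)
qed

text \<open>The gap is a supremum of the linear functionals \<open>grad x\<close> over a bounded set (shifted by
  \<open>x\<close> for the Frank-Wolfe gap), so Lipschitz continuity of the gradient carries over to it.\<close>

lemma gap_lipschitz: "\<exists>C. \<forall>x\<in>D. \<forall>y\<in>D. gap vr A grad x - gap vr A grad y \<le> C * norm (x - y)"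
proof (cases "vr = AdaMP")
  case True
  have "mp_gap A grad x - mp_gap A grad y \<le> (L * radius A) * norm (x - y)"
    if xy: "x \<in> D" "y \<in> D" for x y
  proof -
    have "mp_gap A grad x \<le> mp_gap A grad y + (L * radius A) * norm (x - y)"
    proof (rule mp_gap_le[OF atoms_nonempty])
      fix s assume s: "s \<in> sym_atoms A"
      have "(grad x - grad y) \<bullet> s \<le> norm (grad x - grad y) * norm s"
        by (rule norm_cauchy_schwarz)
      also have "\<dots> \<le> (L * norm (x - y)) * radius A"
        using lipschitz_on_normD[OF lip xy] norm_sym_atom_le_radius[OF bounded_atoms s] L_pos
        by (intro mult_mono) auto
      finally show "grad x \<bullet> s \<le> mp_gap A grad y + (L * radius A) * norm (x - y)"
        using mp_gap_ge[OF bounded_atoms s, of grad y] by (simp add: inner_diff_left algebra_simps)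
    qed
    then show ?thesis by simp
  qed
  then show ?thesis using True by (auto simp: gap_def)
next
  case False
  then have D: "D = convex hull A" by (simp add: feasible_set_def)
  let ?d = "diameter A"
  have d: "norm (x - y) \<le> ?d" if "x \<in> D" "y \<in> D" for x y
    using norm_diff_hull_le_diameter[OF bounded_atoms] that D by simp
  have x0: "x0 \<in> D" using x0_atom by (simp add: D hull_inc)
  let ?C = "L * ?d + (norm (grad x0) + L * ?d)"
  have "fw_gap A grad x - fw_gap A grad y \<le> ?C * norm (x - y)" if xy: "x \<in> D" "y \<in> D" for x y
  proof -
    have "fw_gap A grad x \<le> fw_gap A grad y + ?C * norm (x - y)"
    proof (rule fw_gap_le[OF atoms_nonempty])
      fix s assume "s \<in> A"
      then have s: "s \<in> D" by (simp add: D hull_inc)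
      have "(grad x - grad y) \<bullet> (x - s) \<le> norm (grad x - grad y) * norm (x - s)"
        by (rule norm_cauchy_schwarz)
      also have "\<dots> \<le> (L * norm (x - y)) * ?d"
        using lipschitz_on_normD[OF lip xy] d[OF xy(1) s] L_pos by (intro mult_mono) auto
      finally have 1: "(grad x - grad y) \<bullet> (x - s) \<le> (L * ?d) * norm (x - y)"
        by (simp add: algebra_simps)
      have "norm (grad y) \<le> norm (grad x0) + norm (grad y - grad x0)"
        using norm_triangle_ineq[of "grad x0" "grad y - grad x0"] by simp
      also have "norm (grad y - grad x0) \<le> L * norm (y - x0)"
        by (rule lipschitz_on_normD[OF lip xy(2) x0])
      also have "\<dots> \<le> L * ?d" using d[OF xy(2) x0] L_pos by simp
      finally have "norm (grad y) * norm (x - y) \<le> (norm (grad x0) + L * ?d) * norm (x - y)"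
        by (simp add: mult_right_mono)
      then have 2: "grad y \<bullet> (x - y) \<le> (norm (grad x0) + L * ?d) * norm (x - y)"
        using norm_cauchy_schwarz[of "grad y" "x - y"] by linarith
      have 3: "grad y \<bullet> (y - s) \<le> fw_gap A grad y"
        using fw_gap_ge[OF bounded_atoms, of s grad y] s by (simp add: D)
      have "grad x \<bullet> (x - s) = (grad x - grad y) \<bullet> (x - s) + grad y \<bullet> (x - y) + grad y \<bullet> (y - s)"
        by (simp add: inner_diff_left inner_diff_right)
      then show "grad x \<bullet> (x - s) \<le> fw_gap A grad y + ?C * norm (x - y)"
        using 1 2 3 by (simp add: distrib_right)
    qed
    then show ?thesis by simp
  qed
  then show ?thesis using False unfolding gap_def by auto
qed

lemma fw_oracle_gap:
  assumes "fw_oracle A grad \<delta> r k"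
  shows "\<delta> * fw_gap A grad (X k) \<le> grad (X k) \<bullet> (X k - fw_atom r k)" "fw_atom r k \<in> A"
proof -
  let ?x = "X k" and ?s = "fw_atom r k"
  have "grad ?x \<bullet> (?s - ?x) \<le> \<delta> * (grad ?x \<bullet> (a - ?x))" if "a \<in> A" for a
    using approx_argmin_le[OF assms[unfolded fw_oracle_def] _ that] params by simp
  then have "grad ?x \<bullet> (?x - a) * \<delta> \<le> grad ?x \<bullet> (?x - ?s)" if "a \<in> A" for a
    using that by (simp add: inner_diff_right algebra_simps)
  then have "grad ?x \<bullet> (?x - a) \<le> grad ?x \<bullet> (?x - ?s) / \<delta>" if "a \<in> A" for a
    using that params by (simp only: pos_le_divide_eq)
  then have "fw_gap A grad ?x \<le> grad ?x \<bullet> (?x - ?s) / \<delta>"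
    by (rule fw_gap_le[where grad=grad, OF atoms_nonempty])
  then show "\<delta> * fw_gap A grad ?x \<le> grad ?x \<bullet> (?x - ?s)"
    using params by (simp add: pos_le_divide_eq mult.commute)
  show "?s \<in> A" using assms by (simp add: fw_oracle_def approx_argmin_def)
qed

text \<open>The iterate is an average of active atoms, so the best away direction does not ascend
  to first order; neither does an approximately best one, whatever its quality.\<close>

lemma away_oracle_nonpos:
  assumes rep: "convex_rep A (active r k) (weight r k) (X k)" and "away_oracle grad \<delta> r k"
  shows "grad (X k) \<bullet> (X k - away_atom r k) \<le> 0" "away_atom r k \<in> active r k"
    "away_atom r k \<in> A"
proof -
  let ?x = "X k" and ?v = "away_atom r k"
  let ?q = "grad ?x \<bullet> (?x - ?v) / \<delta>"
  show v: "?v \<in> active r k" using assms by (simp add: away_oracle_def approx_argmin_def)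
  then show "?v \<in> A" using rep by (auto simp: convex_rep_def)
  have "grad ?x \<bullet> (?x - ?v) \<le> \<delta> * (grad ?x \<bullet> (?x - a))" if "a \<in> active r k" for a
    using approx_argmin_le[OF assms(2)[unfolded away_oracle_def] _ that] params by simp
  then have "grad ?x \<bullet> (?x - ?v) \<le> grad ?x \<bullet> (?x - a) * \<delta>" if "a \<in> active r k" for a
    using that by (simp only: mult.commute)
  then have "?q \<le> grad ?x \<bullet> (?x - a)" if "a \<in> active r k" for a
    using that params by (simp only: pos_divide_le_eq)
  then have "?q - grad ?x \<bullet> ?x \<le> (- grad ?x) \<bullet> a" if "a \<in> active r k" for a
    using that by (simp add: inner_diff_right algebra_simps)
  then have "?q - grad ?x \<bullet> ?x \<le> (- grad ?x) \<bullet> ?x"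
    using convex_rep_in_hull_active[OF rep] by (rule inner_ge_on_convex_hull)
  then show "grad ?x \<bullet> (?x - ?v) \<le> 0" using params by (simp add: divide_le_0_iff)
qed

lemma mp_oracle_gap:
  assumes "mp_oracle A grad \<delta> r k"
  shows "\<delta> * mp_gap A grad (X k) \<le> (- grad (X k)) \<bullet> fw_atom r k" "fw_atom r k \<in> sym_atoms A"
proof -
  let ?x = "X k" and ?s = "fw_atom r k"
  have *: "grad ?x \<bullet> ?s \<le> \<delta> * (grad ?x \<bullet> a)" if "a \<in> sym_atoms A" for a
    using approx_argmin_le[OF assms[unfolded mp_oracle_def] _ that] params by simp
  have "grad ?x \<bullet> a * \<delta> \<le> (- grad ?x) \<bullet> ?s" if "a \<in> sym_atoms A" for a
    using *[OF uminus_sym_atoms[OF that]] by (simp add: algebra_simps)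
  then have "grad ?x \<bullet> a \<le> (- grad ?x) \<bullet> ?s / \<delta>" if "a \<in> sym_atoms A" for a
    using that params by (simp only: pos_le_divide_eq)
  then have "mp_gap A grad ?x \<le> (- grad ?x) \<bullet> ?s / \<delta>"
    by (rule mp_gap_le[OF atoms_nonempty])
  then have "mp_gap A grad ?x * \<delta> \<le> (- grad ?x) \<bullet> ?s"
    using params by (simp only: pos_le_divide_eq)
  then show "\<delta> * mp_gap A grad ?x \<le> (- grad ?x) \<bullet> ?s"
    by (simp add: mult.commute)
  show "?s \<in> sym_atoms A" using assms by (simp add: mp_oracle_def approx_argmin_def)
qed

lemma away_step_max:
  assumes "convex_rep A (active r k) (weight r k) (X k)" "away_atom r k \<in> active r k"
    and "direct r k = X k - away_atom r k" "0 < slope k"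
    and "step_max r k = ereal (weight r k (away_atom r k)) / ereal (1 - weight r k (away_atom r k))"
  defines "\<alpha> \<equiv> weight r k (away_atom r k)"
  shows "0 < \<alpha>" "\<alpha> < 1" "step_max r k = ereal (\<alpha> / (1 - \<alpha>))"
proof -
  show "0 < \<alpha>" using assms by (auto simp: convex_rep_def)
  have "\<alpha> \<noteq> 1" using convex_rep_weight_1[OF assms(1,2)] assms by auto
  then show "\<alpha> < 1" using convex_rep_weight_le_1[OF assms(1,2)] \<alpha>_def by linarith
  then show "step_max r k = ereal (\<alpha> / (1 - \<alpha>))" using assms by simp
qed

text \<open>The slope along the direction dominates the gap. For an away step this holds because the
  away direction was preferred to the Frank-Wolfe direction; for a pairwise step because the
  slope is the sum of both and the away part is nonnegative. Feasibility up to the maximal step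
  follows from the weights being nonnegative until then.\<close>

lemma direction_sound:
  assumes state: "sound_state k" and rule: "direction_rule vr A grad \<delta> r k" and pos: "0 < slope k"
  shows "\<delta> * G k \<le> slope k" "norm (direct r k) \<le> direction_bound" "0 < step_max r k"
    "\<And>\<gamma>. 0 < \<gamma> \<Longrightarrow> ereal \<gamma> \<le> step_max r k \<Longrightarrow> X k + \<gamma> *\<^sub>R direct r k \<in> D"
proof -
  have XD: "X k \<in> D" using state by (simp add: sound_state_def)
  have hull: "norm (a - b) \<le> diameter A" if "a \<in> convex hull A" "b \<in> convex hull A" for a b
    using norm_diff_hull_le_diameter bounded_atoms that by blast
  have "\<delta> * G k \<le> slope k \<and> norm (direct r k) \<le> direction_bound \<and> 0 < step_max r k \<and>
    (\<forall>\<gamma>>0. ereal \<gamma> \<le> step_max r k \<longrightarrow> X k + \<gamma> *\<^sub>R direct r k \<in> D)"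
  proof (cases "vr = AdaMP")
    case True
    then have *: "mp_oracle A grad \<delta> r k" "direct r k = fw_atom r k" "step_max r k = \<infinity>"
      using rule by (auto simp: direction_rule_def)
    have s: "fw_atom r k \<in> sym_atoms A" by (rule mp_oracle_gap(2)[OF *(1)])
    then have "fw_atom r k \<in> span A" by (auto simp: sym_atoms_def span_base span_neg)
    then have "X k + \<gamma> *\<^sub>R fw_atom r k \<in> span A" for \<gamma>
      using XD True by (simp add: feasible_set_def span_add span_scale)
    moreover have "D = span A" "G k = mp_gap A grad (X k)" "direction_bound = radius A"
      unfolding feasible_set_def gap_def direction_bound_def using True by simp_all
    ultimately show ?thesis
      using * mp_oracle_gap(1)[OF *(1)] norm_sym_atom_le_radius[OF bounded_atoms s] by simp
  next
    case False
    then have D: "D = convex hull A" "G k = fw_gap A grad (X k)" "direction_bound = diameter A"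
      by (auto simp: feasible_set_def gap_def direction_bound_def)
    have fw: "fw_oracle A grad \<delta> r k"
      using rule False by (auto simp: direction_rule_def split: variant.splits if_splits)
    note s = fw_oracle_gap[OF fw]
    have s_hull: "fw_atom r k \<in> convex hull A" using s by (simp add: hull_inc)
    have fw_case: ?thesis if "direct r k = fw_atom r k - X k" "step_max r k = 1"
    proof -
      have "X k + \<gamma> *\<^sub>R (fw_atom r k - X k) \<in> D" if "0 < \<gamma>" "\<gamma> \<le> 1" for \<gamma>
      proof -
        have "(1 - \<gamma>) *\<^sub>R X k + \<gamma> *\<^sub>R fw_atom r k \<in> D"
          using convex_D XD s_hull D that by (simp add: convex_alt)
        then show ?thesis by (simp add: algebra_simps)
      qed
      then show ?thesis using that s hull[OF s_hull] XD D by (auto simp: inner_diff_right one_ereal_def)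
    qed
    consider "vr = AdaFW" | "vr = AdaAFW" | "vr = AdaPFW" using False by (cases vr) auto
    then show ?thesis
    proof cases
      case 1
      then show ?thesis using fw_case rule by (simp add: direction_rule_def)
    next
      case 2
      show ?thesis
      proof (cases "fw_step_chosen grad r k")
        case True
        then show ?thesis using 2 fw_case rule by (simp add: direction_rule_def)
      next
        case away: False
        have rep: "convex_rep A (active r k) (weight r k) (X k)"
          using state 2 unfolding sound_state_def tracks_weights_def by simp
        have *: "away_oracle grad \<delta> r k" "direct r k = X k - away_atom r k"
          "step_max r k = ereal (weight r k (away_atom r k)) / ereal (1 - weight r k (away_atom r k))"
          using rule 2 away by (auto simp: direction_rule_def)
        note v = away_oracle_nonpos[OF rep *(1)]
        note st = away_step_max[OF rep v(2) *(2) pos *(3)]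
        have "X k + \<gamma> *\<^sub>R (X k - away_atom r k) \<in> D" if "0 < \<gamma>" "ereal \<gamma> \<le> step_max r k" for \<gamma>
          using convex_rep_in_hull[OF convex_rep_away_step[OF rep v(2) st(2) that(1)]] that st(3) D
          by simp
        moreover have "\<delta> * G k \<le> slope k"
          using s(1) away D * by (simp add: fw_step_chosen_def inner_diff_right)
        moreover have "norm (direct r k) \<le> direction_bound"
          using hull XD D v(3) *(2) by (simp add: hull_inc)
        moreover have "0 < step_max r k" using st by simp
        ultimately show ?thesis using *(2) by simp
      qed
    next
      case 3
      have rep: "convex_rep A (active r k) (weight r k) (X k)"
        using state 3 unfolding sound_state_def tracks_weights_def by simp
      have *: "away_oracle grad \<delta> r k" "direct r k = fw_atom r k - away_atom r k"
          "step_max r k = ereal (weight r k (away_atom r k))"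
        using rule 3 by (auto simp: direction_rule_def)
      note v = away_oracle_nonpos[OF rep *(1)]
      have ne: "fw_atom r k \<noteq> away_atom r k" using pos *(2) by auto
      have "X k + \<gamma> *\<^sub>R (fw_atom r k - away_atom r k) \<in> D"
        if "0 < \<gamma>" "ereal \<gamma> \<le> step_max r k" for \<gamma>
        using convex_rep_in_hull[OF convex_rep_pairwise_step[OF rep s(2) ne v(2) that(1)]]
          that *(3) D by simp
      moreover have "\<delta> * G k \<le> slope k"
        using s(1) v(1) D * by (simp add: inner_diff_right)
      moreover have "norm (direct r k) \<le> direction_bound"
        using hull s_hull D v(3) *(2) by (simp add: hull_inc)
      moreover have "0 < step_max r k" using rep v(2) *(3) by (auto simp: convex_rep_def)
      ultimately show ?thesis using *(2) by simp
    qed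
  qed
  then show "\<delta> * G k \<le> slope k" "norm (direct r k) \<le> direction_bound" "0 < step_max r k"
    "\<And>\<gamma>. 0 < \<gamma> \<Longrightarrow> ereal \<gamma> \<le> step_max r k \<Longrightarrow> X k + \<gamma> *\<^sub>R direct r k \<in> D" by auto
qed

text \<open>An atom leaves the active set exactly when its weight vanishes, so the update of the set and
  the update of the weights stay consistent.\<close>

lemma tracks_weights_Suc:
  assumes state: "sound_state k" and rule: "direction_rule vr A grad \<delta> r k" and pos: "0 < slope k"
    and upd: "active_update vr grad r k" and step: "X (Suc k) = X k + step_size r k *\<^sub>R direct r k"
    and \<gamma>: "0 < step_size r k" "ereal (step_size r k) \<le> step_max r k"
  shows "tracks_weights (Suc k)"
  unfolding tracks_weights_def
proof
  assume vr: "vr = AdaAFW \<or> vr = AdaPFW"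
  then have rep: "convex_rep A (active r k) (weight r k) (X k)"
    using state by (simp add: sound_state_def tracks_weights_def)
  have orc: "fw_oracle A grad \<delta> r k" "away_oracle grad \<delta> r k"
    using rule vr by (auto simp: direction_rule_def)
  note s = fw_oracle_gap(2)[OF orc(1)] and v = away_oracle_nonpos(2)[OF rep orc(2)]
  show "convex_rep A (active r (Suc k)) (weight r (Suc k)) (X (Suc k))"
  proof (cases "vr = AdaAFW")
    case True
    show ?thesis
    proof (cases "fw_step_chosen grad r k")
      case fw: True
      then have "step_size r k \<le> 1" "direct r k = fw_atom r k - X k"
        using rule \<gamma> True by (auto simp: direction_rule_def one_ereal_def)
      with convex_rep_fw_step[OF rep s \<gamma>(1)] show ?thesis
        using upd step True fw by (simp add: active_update_def Let_def)
    next
      case away: False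
      have *: "direct r k = X k - away_atom r k"
          "step_max r k = ereal (weight r k (away_atom r k)) / ereal (1 - weight r k (away_atom r k))"
        using rule True away by (auto simp: direction_rule_def)
      note st = away_step_max[OF rep v *(1) pos *(2)]
      have le: "step_size r k \<le> weight r k (away_atom r k) / (1 - weight r k (away_atom r k))"
        using \<gamma>(2) st(3) by simp
      from convex_rep_away_step[OF rep v st(2) \<gamma>(1) le] show ?thesis
        using upd step True away *(1) st(3) by (simp add: active_update_def Let_def)
    qed
  next
    case False
    then have pfw: "vr = AdaPFW" using vr by simp
    then have *: "direct r k = fw_atom r k - away_atom r k"
        "step_max r k = ereal (weight r k (away_atom r k))"
      using rule by (auto simp: direction_rule_def)
    have ne: "fw_atom r k \<noteq> away_atom r k" using pos * by auto
    have le: "step_size r k \<le> weight r k (away_atom r k)" using \<gamma>(2) *(2) by simp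
    from convex_rep_pairwise_step[OF rep s ne v \<gamma>(1) le] show ?thesis
      using upd step pfw *(1) by (simp add: active_update_def Let_def)
  qed
qed

text \<open>The induction step for all invariants. An estimate \<open>M' \<ge> L\<close> always passes the test since its
  trial point is feasible, where the quadratic bound applies; this keeps the estimates bounded.\<close>

lemma iteration_sound:
  assumes state: "sound_state k" and it: "carried_out k"
  shows "sound_state (Suc k)" "0 < slope k" "0 < M k" "M k \<le> lip_bound" "0 < step_size r k"
    "ereal (step_size r k) = min (ereal (slope k / (M k * (norm (direct r k))\<^sup>2))) (step_max r k)"
    "f (X (Suc k)) \<le> f (X k) - step_size r k * slope k / 2"
proof -
  have rule: "direction_rule vr A grad \<delta> r k" and g: "\<delta> * \<epsilon> < slope k"
    and bt: "backtracking f \<tau> \<eta> (prev_est k) (X k) (slope k) (direct r k) (step_max r k) (M k)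
        (step_size r k)"
    and step: "X (Suc k) = X k + step_size r k *\<^sub>R direct r k"
    and upd: "active_update vr grad r k"
    using it unfolding iteration_def Let_def prev_est_def by auto
  have "0 \<le> \<delta> * \<epsilon>" using params by simp
  then show pos: "0 < slope k" using g by linarith
  then have d: "direct r k \<noteq> 0" by auto
  note dir = direction_sound[OF state rule pos]
  have XD: "X k \<in> D" and prev: "0 < prev_est k" "prev_est k \<le> lip_bound"
    using state by (auto simp: sound_state_def)
  have safe: "sufficient_decrease f (X k) (slope k) (direct r k) (step_max r k) M'"
    if M': "0 < M'" "L \<le> M'" for M'
  proof -
    define \<gamma> where "\<gamma> = trial_step (slope k) (direct r k) (step_max r k) M'"
    have "0 < \<gamma>" using trial_step_pos[OF dir(3) pos M'(1) d] by (simp add: \<gamma>_def)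
    moreover have "ereal \<gamma> \<le> step_max r k" unfolding \<gamma>_def trial_step_eq_min[OF dir(3)] by simp
    ultimately have "X k + \<gamma> *\<^sub>R direct r k \<in> D" by (rule dir(4))
    then have "f (X k + \<gamma> *\<^sub>R direct r k)
        \<le> f (X k) + grad (X k) \<bullet> (\<gamma> *\<^sub>R direct r k) + L / 2 * (norm (\<gamma> *\<^sub>R direct r k))\<^sup>2"
      by (rule smooth_quadratic_bound[OF convex_D deriv lip XD])
    also have "\<dots> = f (X k) - \<gamma> * slope k + \<gamma>\<^sup>2 / 2 * (norm (direct r k))\<^sup>2 * L"
      by (simp add: power_mult_distrib algebra_simps)
    also have "\<dots> \<le> f (X k) - \<gamma> * slope k + \<gamma>\<^sup>2 / 2 * (norm (direct r k))\<^sup>2 * M'"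
      using M' by (simp add: mult_left_mono)
    finally show ?thesis
      unfolding sufficient_decrease_def Let_def \<gamma>_def[symmetric] by (simp add: algebra_simps)
  qed
  note out = backtracking_outcome[where L = L, OF bt prev(1) params(4,3) pos d dir(3) safe]
  show "0 < M k" "0 < step_size r k"
    "ereal (step_size r k) = min (ereal (slope k / (M k * (norm (direct r k))\<^sup>2))) (step_max r k)"
    "f (X (Suc k)) \<le> f (X k) - step_size r k * slope k / 2"
    using out step by auto
  show Mb: "M k \<le> lip_bound" using out(2) prev(2) by (simp add: lip_bound_def)
  have le: "ereal (step_size r k) \<le> step_max r k" using out(4) by (metis min.cobounded2)
  show "sound_state (Suc k)"
    unfolding sound_state_def
  proof (intro conjI)
    show "X (Suc k) \<in> D" using dir(4)[OF out(3) le] step by simp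
    show "tracks_weights (Suc k)" by (rule tracks_weights_Suc[OF state rule pos upd step out(3) le])
    show "0 < prev_est (Suc k)" "prev_est (Suc k) \<le> lip_bound"
      using out(1) Mb by (auto simp: prev_est_def)
  qed
qed

lemma sound_state_0: "sound_state 0"
proof -
  have X0: "X 0 = x0" and act: "active r 0 = {x0}" "weight r 0 = (\<lambda>v. if v = x0 then 1 else 0)"
    using start by (auto simp: starts_at_def)
  have "x0 \<in> D" using x0_atom by (simp add: feasible_set_def hull_inc span_base)
  moreover have "convex_rep A {x0} (weight r 0) x0"
    using x0_atom act by (auto simp: convex_rep_def)
  ultimately show ?thesis
    using X0 act params by (simp add: sound_state_def tracks_weights_def prev_est_def lip_bound_def)
qed

lemma sound_states: "(\<forall>j<k. carried_out j) \<Longrightarrow> sound_state k"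
  by (induction k) (auto intro: sound_state_0 iteration_sound(1))

section \<open>Decrease of the objective\<close>

lemma direction_bound_pos:
  assumes "\<forall>j\<le>k. carried_out j"
  shows "0 < direction_bound"
proof -
  have state: "sound_state k" and it: "carried_out k" using assms sound_states by auto
  have rule: "direction_rule vr A grad \<delta> r k" using it by (simp add: iteration_def Let_def)
  have pos: "0 < slope k" using iteration_sound[OF state it] by blast
  then have "direct r k \<noteq> 0" by auto
  then show ?thesis using direction_sound(2)[OF state rule pos]
    by (meson less_le_trans zero_less_norm_iff)
qed

lemma slope_ge_gap:
  assumes "\<forall>j\<le>k. carried_out j"
  shows "\<delta> * G k \<le> slope k"
proof -
  have state: "sound_state k" and it: "carried_out k" using assms sound_states by auto
  have rule: "direction_rule vr A grad \<delta> r k" using it by (simp add: iteration_def Let_def)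
  show ?thesis using direction_sound(1)[OF state rule] iteration_sound(2)[OF state it] by blast
qed

lemma gap_iterate_nonneg:
  assumes "\<forall>j<k. carried_out j" shows "0 \<le> G k"
  using gap_nonneg sound_states[OF assms] by (auto simp: sound_state_def)

text \<open>An iteration moves by at most \<open>step_size r k * direction_bound\<close> and decreases \<open>f\<close> by at least
  half the step-size times the slope, good step or not.\<close>

lemma decrease_ge_movement:
  assumes "\<forall>j\<le>k. carried_out j"
  shows "\<delta> / (2 * direction_bound) * G k * norm (X (Suc k) - X k) \<le> f (X k) - f (X (Suc k))"
proof -
  have state: "sound_state k" and it: "carried_out k" using assms sound_states by auto
  have rule: "direction_rule vr A grad \<delta> r k" and step: "X (Suc k) = X k + step_size r k *\<^sub>R direct r k"
    using it by (simp_all add: iteration_def Let_def)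
  note it = iteration_sound[OF state it]
  have B: "0 < direction_bound" and G: "0 \<le> G k"
    using direction_bound_pos gap_iterate_nonneg assms by auto
  have "norm (X (Suc k) - X k) = step_size r k * norm (direct r k)" using it step by simp
  also have "\<dots> \<le> step_size r k * direction_bound"
    using direction_sound(2)[OF state rule it(2)] it by simp
  finally have "\<delta> / (2 * direction_bound) * G k * norm (X (Suc k) - X k)
      \<le> \<delta> / (2 * direction_bound) * G k * (step_size r k * direction_bound)"
    using B G params by (intro mult_left_mono) auto
  also have "\<dots> = step_size r k * (\<delta> * G k) / 2" using B by simp
  also have "\<dots> \<le> step_size r k * slope k / 2"
    using mult_left_mono[OF slope_ge_gap[OF assms], of "step_size r k"] it(5) by linarith
  finally show ?thesis using it(7) by linarith
qed

lemma objective_Suc_less: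
  assumes "\<forall>j\<le>k. carried_out j" shows "f (X (Suc k)) < f (X k)"
proof -
  have state: "sound_state k" and it: "carried_out k" using assms sound_states by auto
  have "0 < step_size r k * slope k" using iteration_sound(2,5)[OF state it] by (intro mult_pos_pos)
  then show ?thesis using iteration_sound(7)[OF state it] by linarith
qed

lemma objective_strict_anti:
  assumes "\<forall>j<n. carried_out j" "i < j" "j \<le> n"
  shows "f (X j) < f (X i)"
  using assms(2,3)
proof (induction j)
  case (Suc j)
  then have "f (X (Suc j)) < f (X j)" using assms(1) by (intro objective_Suc_less) auto
  then show ?case using Suc by (cases "i = j") auto
qed simp

text \<open>A good step either takes the minimiser of the quadratic model or has length at least one,
  and the latter cannot happen without a step-size limit.\<close>

lemma good_step_decrease:
  assumes run: "\<forall>j\<le>k. carried_out j" and good: "\<not> bad_step r k"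
  shows "(slope k)\<^sup>2 / (2 * M k * direction_bound\<^sup>2) \<le> f (X k) - f (X (Suc k))
    \<or> vr \<noteq> AdaMP \<and> slope k / 2 \<le> f (X k) - f (X (Suc k))"
proof -
  have state: "sound_state k" and it: "carried_out k" using assms sound_states by auto
  have rule: "direction_rule vr A grad \<delta> r k" using it by (simp add: iteration_def Let_def)
  note it = iteration_sound[OF state it]
  have d: "direct r k \<noteq> 0" using it(2) by auto
  let ?q = "slope k / (M k * (norm (direct r k))\<^sup>2)"
  consider "step_size r k = ?q" | "ereal (step_size r k) = step_max r k"
    using it(6) by (metis min_def ereal.inject)
  then show ?thesis
  proof cases
    case 1
    have "M k * (norm (direct r k))\<^sup>2 \<le> M k * direction_bound\<^sup>2"
      using direction_sound(2)[OF state rule it(2)] it(3) by (simp add: power_mono)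
    then have "(slope k)\<^sup>2 / (2 * (M k * direction_bound\<^sup>2))
        \<le> (slope k)\<^sup>2 / (2 * (M k * (norm (direct r k))\<^sup>2))"
      using it(3) d direction_bound_pos[OF run] by (intro divide_left_mono) auto
    also have "\<dots> = step_size r k * slope k / 2"
      using 1 by (simp add: power2_eq_square)
    finally show ?thesis using it(7) by (simp add: mult.assoc)
  next
    case 2
    then have "1 \<le> ereal (step_size r k)" using good by (simp add: bad_step_def not_less)
    then have "1 \<le> step_size r k" by (simp add: one_ereal_def)
    then have "slope k \<le> step_size r k * slope k" using it(2) by simp
    moreover have "vr \<noteq> AdaMP" using 2 rule by (auto simp: direction_rule_def)
    ultimately show ?thesis using it(7) by auto
  qed
qed

lemma sum_decrease_le_subopt:
  assumes run: "\<forall>j\<le>t. carried_out j" and I: "I \<subseteq> {..t}"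
  shows "(\<Sum>k\<in>I. f (X k) - f (X (Suc k))) \<le> subopt vr A f (X 0)"
proof -
  have "0 \<le> f (X k) - f (X (Suc k))" if "k \<le> t" for k
    using objective_Suc_less[of k] run that by fastforce
  then have "(\<Sum>k\<in>I. f (X k) - f (X (Suc k))) \<le> (\<Sum>k\<le>t. f (X k) - f (X (Suc k)))"
    using I by (intro sum_mono2) auto
  also have "\<dots> = f (X 0) - f (X (Suc t))"
    using sum_lessThan_telescope'[of "\<lambda>k. f (X k)" "Suc t"] by (simp add: lessThan_Suc_atMost)
  also have "\<dots> \<le> f (X 0) - (INF y\<in>D. f y)"
    using sound_states[of "Suc t"] run min_le[of "X (Suc t)"] by (simp add: sound_state_def)
  finally show ?thesis by (simp add: subopt_def)
qed

section \<open>Counting good steps\<close>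

definition good_count :: "nat \<Rightarrow> nat" where
  "good_count n = card {k. k < n \<and> \<not> bad_step r k}"

lemma num_good_eq: "num_good r t = good_count (Suc t)"
  unfolding num_good_def good_steps_def good_count_def
  by (rule arg_cong[of _ _ card]) auto

lemma good_count_Suc: "good_count (Suc n) = good_count n + (if bad_step r n then 0 else 1)"
proof -
  have "{k. k < Suc n \<and> \<not> bad_step r k} =
      (if bad_step r n then {} else {n}) \<union> {k. k < n \<and> \<not> bad_step r k}"
    by (auto simp: less_Suc_eq)
  then show ?thesis by (simp add: good_count_def)
qed

lemma good_count_mono: "m \<le> n \<Longrightarrow> good_count m \<le> good_count n"
  unfolding good_count_def by (intro card_mono) auto

text \<open>Every bad away step removes an atom, while a step adds at most one and the active set
  never becomes empty.\<close>

lemma away_good_count: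
  assumes "vr = AdaAFW" "\<forall>j<n. carried_out j"
  shows "card (active r n) + n \<le> 1 + 2 * good_count n"
  using assms(2)
proof (induction n)
  case 0
  then show ?case using start by (simp add: starts_at_def)
next
  case (Suc n)
  have state: "sound_state n" and it: "carried_out n" using Suc.prems sound_states by auto
  have rep: "convex_rep A (active r n) (weight r n) (X n)"
    using state assms(1) unfolding sound_state_def tracks_weights_def by simp
  have rule: "direction_rule vr A grad \<delta> r n" and upd: "active_update vr grad r n"
    using it by (simp_all add: iteration_def Let_def)
  have fin: "finite (active r n)" using rep by (simp add: convex_rep_def)
  have IH: "card (active r n) + n \<le> 1 + 2 * good_count n" using Suc by simp
  show ?case
  proof (cases "fw_step_chosen grad r n")
    case True
    then have "step_max r n = 1" using rule assms(1) by (simp add: direction_rule_def)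
    then have "\<not> bad_step r n" by (simp add: bad_step_def)
    moreover have "active r (Suc n) = {fw_atom r n} \<or>
        active r (Suc n) = insert (fw_atom r n) (active r n)"
      using upd assms(1) True by (auto simp: active_update_def Let_def)
    then have "card (active r (Suc n)) \<le> Suc (card (active r n))"
      using card_insert_le_m1 fin by (auto simp: card_insert_if)
    ultimately show ?thesis using IH by (simp add: good_count_Suc)
  next
    case False
    then have S': "active r (Suc n) =
        (if ereal (step_size r n) = step_max r n then active r n - {away_atom r n} else active r n)"
      using upd assms(1) by (auto simp: active_update_def Let_def)
    have v: "away_atom r n \<in> active r n"
      using rule assms(1) by (simp add: direction_rule_def away_oracle_def approx_argmin_def)
    have "0 < card (active r n)" using v fin card_gt_0_iff by blast
    then show ?thesis
      using IH S' v fin by (auto simp: good_count_Suc bad_step_def)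
  qed
qed

lemma pairwise_bad_step:
  assumes vr: "vr = AdaPFW" and run: "\<forall>j\<le>k. carried_out j" and bad: "bad_step r k"
  obtains s v where "s \<in> A" "s \<noteq> v"
    "weight r (Suc k) = (weight r k)(s := weight r k s + weight r k v, v := 0)"
proof (rule that)
  have state: "sound_state k" and it: "carried_out k" using run sound_states by auto
  have rule: "direction_rule vr A grad \<delta> r k" and upd: "active_update vr grad r k"
    using it by (simp_all add: iteration_def Let_def)
  show "fw_atom r k \<in> A"
    using rule vr by (simp add: direction_rule_def fw_oracle_def approx_argmin_def)
  have d: "direct r k = fw_atom r k - away_atom r k"
      "step_max r k = ereal (weight r k (away_atom r k))"
    using rule vr by (auto simp: direction_rule_def)
  then show "fw_atom r k \<noteq> away_atom r k" using iteration_sound(2)[OF state it] by auto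
  have "step_size r k = weight r k (away_atom r k)"
    using bad d(2) by (simp add: bad_step_def)
  then show "weight r (Suc k) = (weight r k)(fw_atom r k := weight r k (fw_atom r k)
      + weight r k (away_atom r k), away_atom r k := 0)"
    using upd vr by (simp add: active_update_def Let_def)
qed

text \<open>Bad pairwise steps only move the whole weight of one atom onto another. After a run of
  them, the weights are therefore those at its start pushed forward along a map from the
  atoms to the atoms.\<close>

lemma pairwise_bad_run_weights:
  assumes vr: "vr = AdaPFW" and run: "\<forall>j<k + m. carried_out j"
    and bad: "\<And>j. k \<le> j \<Longrightarrow> j < k + m \<Longrightarrow> bad_step r j"
  shows "\<exists>\<pi>\<in>A \<rightarrow>\<^sub>E A. \<forall>a. weight r (k + m) a = (\<Sum>b\<in>{b\<in>A. \<pi> b = a}. weight r k b)"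
  using run bad
proof (induction m)
  case 0
  have "sound_state k" using sound_states 0 by simp
  then have "convex_rep A (active r k) (weight r k) (X k)"
    using vr unfolding sound_state_def tracks_weights_def by simp
  then have zero: "weight r k a = 0" if "a \<notin> A" for a using that by (auto simp: convex_rep_def)
  have "{b \<in> A. restrict id A b = a} = (if a \<in> A then {a} else {})" for a by auto
  then have "\<forall>a. weight r (k + 0) a = (\<Sum>b\<in>{b\<in>A. restrict id A b = a}. weight r k b)"
    using zero by simp
  moreover have "restrict id A \<in> A \<rightarrow>\<^sub>E A" by auto
  ultimately show ?case by blast
next
  case (Suc m)
  have fin: "finite A" using vr pairwise_finite by blast
  have "\<exists>\<pi>\<in>A \<rightarrow>\<^sub>E A. \<forall>a. weight r (k + m) a = (\<Sum>b\<in>{b\<in>A. \<pi> b = a}. weight r k b)"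
    by (rule Suc.IH) (use Suc.prems in auto)
  then obtain \<pi> where \<pi>: "\<pi> \<in> A \<rightarrow>\<^sub>E A"
    and w: "\<And>a. weight r (k + m) a = (\<Sum>b\<in>{b\<in>A. \<pi> b = a}. weight r k b)"
    by blast
  obtain s v where sv: "s \<in> A" "s \<noteq> v"
    and w': "weight r (Suc (k + m)) =
      (weight r (k + m))(s := weight r (k + m) s + weight r (k + m) v, v := 0)"
  proof (rule pairwise_bad_step[OF vr, of "k + m"])
    show "\<forall>j\<le>k + m. carried_out j" "bad_step r (k + m)" using Suc.prems by simp_all
  qed
  (* The mass that had arrived at v is sent on to s. *)
  define \<pi>' where "\<pi>' = (\<lambda>b\<in>A. if \<pi> b = v then s else \<pi> b)"
  have "weight r (k + Suc m) a = (\<Sum>b\<in>{b\<in>A. \<pi>' b = a}. weight r k b)" for a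
  proof -
    consider "a = v" | "a = s" | "a \<noteq> v" "a \<noteq> s" by blast
    then show ?thesis
    proof cases
      case 1
      then have "{b\<in>A. \<pi>' b = a} = {}" using sv by (auto simp: \<pi>'_def)
      then show ?thesis using 1 w' by (simp only: add_Suc_right) simp
    next
      case 2
      then have "{b\<in>A. \<pi>' b = a} = {b\<in>A. \<pi> b = s} \<union> {b\<in>A. \<pi> b = v}"
        by (auto simp: \<pi>'_def)
      moreover have "{b\<in>A. \<pi> b = s} \<inter> {b\<in>A. \<pi> b = v} = {}" using sv by auto
      ultimately have "(\<Sum>b\<in>{b\<in>A. \<pi>' b = a}. weight r k b) = weight r (k + m) s + weight r (k + m) v"
        using fin by (simp add: sum.union_disjoint w)
      then show ?thesis using 2 sv w' by simp
    next
      case 3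
      then have "{b\<in>A. \<pi>' b = a} = {b\<in>A. \<pi> b = a}" by (auto simp: \<pi>'_def)
      then show ?thesis using 3 w w' by simp
    qed
  qed
  moreover have "\<pi>' \<in> A \<rightarrow>\<^sub>E A" using \<pi> sv by (auto simp: \<pi>'_def)
  ultimately show ?case by blast
qed

text \<open>The objective decreases strictly, so the iterates of such a run are pairwise distinct,
  and each of them is determined by a map from the finite set of atoms to itself.\<close>

lemma pairwise_bad_run_length:
  assumes vr: "vr = AdaPFW" and run: "\<forall>j<k + m. carried_out j"
    and bad: "\<And>j. k \<le> j \<Longrightarrow> j < k + m \<Longrightarrow> bad_step r j"
  shows "m < card A ^ card A"
proof -
  have fin: "finite A" using vr pairwise_finite by blast
  define P where "P \<pi> = (\<Sum>a\<in>A. (\<Sum>b\<in>{b\<in>A. \<pi> b = a}. weight r k b) *\<^sub>R a)" for \<pi> :: "real ^ 'p \<Rightarrow> real ^ 'p"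
  have "X (k + i) \<in> P ` (A \<rightarrow>\<^sub>E A)" if "i \<le> m" for i
  proof -
    have "\<exists>\<pi>\<in>A \<rightarrow>\<^sub>E A. \<forall>a. weight r (k + i) a = (\<Sum>b\<in>{b\<in>A. \<pi> b = a}. weight r k b)"
      by (rule pairwise_bad_run_weights[OF vr]) (use run bad that in auto)
    then obtain \<pi> where \<pi>: "\<pi> \<in> A \<rightarrow>\<^sub>E A"
      and w: "\<And>a. weight r (k + i) a = (\<Sum>b\<in>{b\<in>A. \<pi> b = a}. weight r k b)"
      by blast
    have "sound_state (k + i)" using sound_states run that by simp
    then have rep: "convex_rep A (active r (k + i)) (weight r (k + i)) (X (k + i))"
      using vr unfolding sound_state_def tracks_weights_def by simp
    have "X (k + i) = P \<pi>"
      using convex_rep_sums(2)[OF rep fin] rep by (simp add: convex_rep_def P_def w)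
    then show ?thesis using \<pi> by blast
  qed
  then have sub: "(\<lambda>i. X (k + i)) ` {..m} \<subseteq> P ` (A \<rightarrow>\<^sub>E A)" by auto
  have "inj_on (\<lambda>i. X (k + i)) {..m}"
  proof (rule linorder_inj_onI)
    fix i j assume "i < j" "i \<in> {..m}" "j \<in> {..m}"
    then have "f (X (k + j)) < f (X (k + i))" using objective_strict_anti[OF run] by simp
    then show "X (k + i) \<noteq> X (k + j)" by auto
  qed auto
  then have "Suc m = card ((\<lambda>i. X (k + i)) ` {..m})" by (simp add: card_image)
  also have "\<dots> \<le> card (P ` (A \<rightarrow>\<^sub>E A))"
    using sub fin by (intro card_mono finite_imageI finite_PiE) auto
  also have "\<dots> \<le> card (A \<rightarrow>\<^sub>E A)" using fin by (intro card_image_le finite_PiE) auto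
  also have "\<dots> = card A ^ card A" using fin by (simp add: card_funcsetE)
  finally show ?thesis by simp
qed

text \<open>Among any \<open>card A ^ card A\<close> consecutive steps at least one is good.\<close>

lemma pairwise_good_count:
  assumes vr: "vr = AdaPFW" and run: "\<forall>j<n. carried_out j"
  shows "n \<le> card A ^ card A * (good_count n + 1)"
  using run
proof (induction n rule: less_induct)
  case (less n)
  let ?b = "card A ^ card A"
  show ?case
  proof (cases "n < ?b")
    case True
    then show ?thesis by simp
  next
    case False
    have "0 < ?b" using pairwise_bad_run_length[OF vr, of 0 0] by simp
    have "\<exists>k. n - ?b \<le> k \<and> k < n \<and> \<not> bad_step r k"
    proof (rule ccontr)
      assume "\<not> ?thesis"
      then have "?b < ?b"
        using less.prems False by (intro pairwise_bad_run_length[OF vr, of "n - ?b"]) auto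
      then show False by simp
    qed
    then obtain k where k: "n - ?b \<le> k" "k < n" "\<not> bad_step r k" by blast
    have "good_count (n - ?b) < good_count (Suc k)"
      using good_count_mono[OF k(1)] k(3) by (simp add: good_count_Suc)
    also have "\<dots> \<le> good_count n" using k(2) by (intro good_count_mono) simp
    finally have "?b * (good_count (n - ?b) + 1) \<le> ?b * good_count n" by (intro mult_le_mono2) simp
    moreover have "n - ?b < n" using \<open>0 < ?b\<close> False by linarith
    then have "n - ?b \<le> ?b * (good_count (n - ?b) + 1)"
      using less.prems by (intro less.IH) auto
    ultimately show ?thesis by simp
  qed
qed

text \<open>The good steps make up a positive fraction of all steps that depends on the number of atoms
  only. For an infinite set of atoms the factor is \<open>0 ^ 0 + 2 = 3\<close>, which suffices for the
  variants that do not require finitely many atoms.\<close>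

lemma good_fraction:
  assumes "\<forall>j<n. carried_out j"
  shows "n \<le> (card A ^ card A + 2) * (good_count n + 1)"
proof (cases vr)
  case AdaAFW
  have "n \<le> 2 * (good_count n + 1)" using away_good_count[OF AdaAFW assms] by simp
  then show ?thesis by (simp add: add_mult_distrib)
next
  case AdaPFW
  then have "n \<le> card A ^ card A * (good_count n + 1)" using pairwise_good_count assms by blast
  then show ?thesis by (simp only: add_mult_distrib)
next
  case AdaFW
  then have "\<not> bad_step r k" if "k < n" for k
    using assms that by (auto simp: iteration_def Let_def direction_rule_def bad_step_def)
  then have "{k. k < n \<and> \<not> bad_step r k} = {..<n}" by auto
  then show ?thesis by (simp add: good_count_def)
next
  case AdaMP
  then have "\<not> bad_step r k" if "k < n" for k
    using assms that by (auto simp: iteration_def Let_def direction_rule_def bad_step_def)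
  then have "{k. k < n \<and> \<not> bad_step r k} = {..<n}" by auto
  then show ?thesis by (simp add: good_count_def)
qed

section \<open>Convergence of the gap\<close>

text \<open>A good step at which the gap is at least \<open>c\<close> decreases \<open>f\<close> by an amount that depends on \<open>c\<close>
  only, and there are infinitely many good steps. Lemma \<open>gap_tendsto_zero\<close> does the rest.\<close>

lemma gap_converges:
  assumes run: "\<forall>j. carried_out j"
  shows "G \<longlonglongrightarrow> 0"
proof -
  let ?B = direction_bound
  obtain C where C: "\<And>x y. x \<in> D \<Longrightarrow> y \<in> D \<Longrightarrow> gap vr A grad x - gap vr A grad y \<le> C * norm (x - y)"
    using gap_lipschitz by blast
  have XD: "X n \<in> D" for n using sound_states[of n] run by (simp add: sound_state_def)
  have B: "0 < ?B" using direction_bound_pos run by blast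
  have lip_bound: "0 < lip_bound" using params by (simp add: lip_bound_def less_max_iff_disj)
  have often_good: "\<exists>n\<ge>N. \<not> bad_step r n" for N
  proof (rule ccontr)
    assume "\<not> ?thesis"
    then have "{k. k < n \<and> \<not> bad_step r k} \<subseteq> {..<N}" for n by (auto simp: not_le[symmetric])
    then have "good_count n \<le> card {..<N}" for n
      unfolding good_count_def by (intro card_mono) auto
    then have "(card A ^ card A + 2) * (good_count n + 1) \<le> (card A ^ card A + 2) * (N + 1)" for n
      by (intro mult_le_mono2) simp
    then have "n \<le> (card A ^ card A + 2) * (N + 1)" for n
      using order_trans[OF good_fraction[of n]] run by blast
    then show False using Suc_n_not_le_n by blast
  qed
  have decr: "\<exists>p>0. \<forall>N. \<exists>n\<ge>N. c \<le> G n \<longrightarrow> p \<le> f (X n) - f (X (Suc n))" if c: "0 < c" for c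
  proof -
    let ?p = "min (\<delta> * c / 2) ((\<delta> * c)\<^sup>2 / (2 * lip_bound * ?B\<^sup>2))"
    have "0 < ?p" using c params B lip_bound by simp
    moreover have "\<exists>n\<ge>N. c \<le> G n \<longrightarrow> ?p \<le> f (X n) - f (X (Suc n))" for N
    proof -
      obtain n where n: "n \<ge> N" "\<not> bad_step r n" using often_good by blast
      have "?p \<le> f (X n) - f (X (Suc n))" if "c \<le> G n"
      proof -
        have "\<delta> * c \<le> \<delta> * G n" using that params by simp
        also have "\<dots> \<le> slope n" using slope_ge_gap run by blast
        finally have sl: "\<delta> * c \<le> slope n" .
        have state: "sound_state n" using sound_states run by blast
        have M: "0 < M n" "M n \<le> lip_bound" using iteration_sound[OF state] run by blast+
        have "(\<delta> * c)\<^sup>2 / (2 * lip_bound * ?B\<^sup>2) \<le> (slope n)\<^sup>2 / (2 * M n * ?B\<^sup>2)"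
          using sl M B c params by (intro frac_le power_mono mult_right_mono) auto
        then show ?thesis using good_step_decrease[of n] n(2) run sl by fastforce
      qed
      then show ?thesis using n by blast
    qed
    ultimately show ?thesis by blast
  qed
  show ?thesis
  proof (rule gap_tendsto_zero[where F = "\<lambda>n. f (X n)" and G = G and x = X and C = C
        and b = "INF y\<in>D. f y" and \<kappa> = "\<delta> / (2 * ?B)"])
    show "(INF y\<in>D. f y) \<le> f (X n)" for n using min_le XD by blast
    show "f (X (Suc n)) \<le> f (X n)" for n using objective_Suc_less[of n] run by simp
    show "0 \<le> G n" for n using gap_nonneg XD by blast
    show "\<delta> / (2 * ?B) * G n * norm (X (Suc n) - X n) \<le> f (X n) - f (X (Suc n))" for n
      using decrease_ge_movement run by blast
    show "0 < \<delta> / (2 * ?B)" using params B by simp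
    show "G n - G m \<le> C * norm (X n - X m)" for n m using C XD by blast
  qed (rule decr)
qed

section \<open>The rate\<close>

lemma good_steps_subset: "finite (good_steps r t)" "good_steps r t \<subseteq> {..t}"
  by (auto simp: good_steps_def)

lemma lip_est_bounds:
  assumes "\<forall>j\<le>t. carried_out j" "k \<le> t"
  shows "0 < M k" "M k \<le> lip_bound"
proof -
  have "sound_state k" "carried_out k" using assms sound_states by auto
  then show "0 < M k" "M k \<le> lip_bound" using iteration_sound by blast+
qed

lemma lip_max_bounds:
  assumes run: "\<forall>j\<le>t. carried_out j" and N: "1 \<le> num_good r t"
  shows "0 < lip_max r t" "lip_max r t \<le> lip_bound" "k \<in> good_steps r t \<Longrightarrow> M k \<le> lip_max r t"
proof -
  have ne: "good_steps r t \<noteq> {}" using N by (auto simp: num_good_def)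
  have "lip_max r t \<in> M ` good_steps r t"
    unfolding lip_max_def using good_steps_subset ne by (intro Max_in) auto
  then have "lip_max r t \<in> M ` {..t}" using good_steps_subset[of t] by blast
  then show "0 < lip_max r t" "lip_max r t \<le> lip_bound"
    using lip_est_bounds[OF run] by auto
  show "k \<in> good_steps r t \<Longrightarrow> M k \<le> lip_max r t"
    unfolding lip_max_def using good_steps_subset by (intro Max_ge) auto
qed

lemma lip_avg_bounds:
  assumes run: "\<forall>j\<le>t. carried_out j" and N: "1 \<le> num_good r t"
  shows "0 < lip_avg r t" "lip_avg r t \<le> lip_bound"
proof -
  have ne: "good_steps r t \<noteq> {}" using N by (auto simp: num_good_def)
  have "0 < sum M (good_steps r t)"
    using lip_est_bounds[OF run] good_steps_subset[of t] ne by (intro sum_pos) auto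
  then show "0 < lip_avg r t" using N by (simp add: lip_avg_def)
  have "sum M (good_steps r t) \<le> (\<Sum>k\<in>good_steps r t. lip_bound)"
    using lip_est_bounds[OF run] good_steps_subset[of t] by (intro sum_mono) auto
  then show "lip_avg r t \<le> lip_bound"
    using N by (simp add: lip_avg_def num_good_def pos_divide_le_eq mult.commute)
qed

lemma subopt_nonneg: "0 \<le> subopt vr A f (X 0)"
  using min_le[of "X 0"] sound_state_0 by (simp add: subopt_def sound_state_def)

text \<open>Each good step decreases \<open>f\<close> by at least the smaller of \<open>u / 2\<close> and \<open>u\<^sup>2 / (2 * q)\<close>, and these
  decreases sum to at most the initial suboptimality. The two cases yield the two terms of the
  maximum in the rate constant; the first is in fact of order \<open>1 / N\<close>, where \<open>N\<close> counts the
  good steps.\<close>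

lemma fw_rate:
  assumes vr: "vr \<noteq> AdaMP" and run: "\<forall>j\<le>t. carried_out j" and N: "1 \<le> num_good r t"
    and u: "0 \<le> u" "\<And>k. k \<le> t \<Longrightarrow> u \<le> slope k"
  shows "u * sqrt (num_good r t) \<le> rate_const vr A f r t"
proof -
  let ?N = "real (num_good r t)" and ?h = "subopt vr A f (X 0)"
  define q where "q = lip_max r t * direction_bound\<^sup>2"
  define C where "C = max (2 * ?h) q"
  have B: "0 < direction_bound" using direction_bound_pos[of 0] run by simp
  have q: "0 < q" using lip_max_bounds(1)[OF run N] B by (simp add: q_def)
  have rate: "rate_const vr A f r t = C"
    using vr unfolding rate_const_def C_def q_def direction_bound_def Let_def by simp
  have dec: "min (u / 2) (u\<^sup>2 / (2 * q)) \<le> f (X k) - f (X (Suc k))" if k: "k \<in> good_steps r t" for k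
  proof -
    have kt: "k \<le> t" "\<not> bad_step r k" using k by (auto simp: good_steps_def)
    have "u\<^sup>2 / (2 * q) \<le> (slope k)\<^sup>2 / (2 * M k * direction_bound\<^sup>2)"
      using u(1) u(2)[OF kt(1)] lip_est_bounds(1)[OF run kt(1)] lip_max_bounds(3)[OF run N k] B
      unfolding q_def mult.assoc[symmetric] by (intro frac_le power_mono mult_right_mono) auto
    then show ?thesis
      using good_step_decrease[of k] kt run u(2)[OF kt(1)] by fastforce
  qed
  have "?N * min (u / 2) (u\<^sup>2 / (2 * q)) \<le> (\<Sum>k\<in>good_steps r t. f (X k) - f (X (Suc k)))"
    using sum_mono[of "good_steps r t", OF dec] by (simp add: num_good_def)
  also have "\<dots> \<le> ?h" by (rule sum_decrease_le_subopt[OF run good_steps_subset(2)])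
  finally have *: "?N * min (u / 2) (u\<^sup>2 / (2 * q)) \<le> ?h" .
  have sq: "1 \<le> sqrt ?N" "sqrt ?N * sqrt ?N = ?N" using N by auto
  show ?thesis
  proof (cases "u / 2 \<le> u\<^sup>2 / (2 * q)")
    case True
    then have "u * ?N \<le> 2 * ?h" using * by (simp add: min_def mult.commute)
    moreover have "sqrt ?N \<le> ?N" using mult_right_mono[OF sq(1), of "sqrt ?N"] sq by simp
    then have "u * sqrt ?N \<le> u * ?N" using u(1) by (rule mult_left_mono)
    ultimately show ?thesis unfolding rate C_def by simp
  next
    case False
    then have "?N * u\<^sup>2 \<le> 2 * ?h * q" using * q by (simp add: min_def pos_divide_le_eq mult_ac)
    also have "\<dots> \<le> C * C"
      using q subopt_nonneg by (intro mult_mono) (auto simp: C_def le_max_iff_disj)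
    finally have "(u * sqrt ?N)\<^sup>2 \<le> C\<^sup>2"
      by (simp add: power_mult_distrib power2_eq_square[of C] mult.commute)
    moreover have "0 \<le> C" using q by (simp add: C_def le_max_iff_disj)
    ultimately show ?thesis unfolding rate by (rule power2_le_imp_le)
  qed
qed

text \<open>Without a step-size limit every decrease is at least \<open>u\<^sup>2 / (2 * M k * direction_bound\<^sup>2)\<close>,
  and the harmonic mean of the estimates is at most their average.\<close>

lemma mp_rate:
  assumes vr: "vr = AdaMP" and run: "\<forall>j\<le>t. carried_out j" and N: "1 \<le> num_good r t"
    and u: "0 \<le> u" "\<And>k. k \<le> t \<Longrightarrow> u \<le> slope k"
  shows "u * sqrt (num_good r t) \<le> rate_const vr A f r t"
proof -
  let ?N = "real (num_good r t)" and ?h = "subopt vr A f (X 0)" and ?B = direction_bound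
  define a where "a = lip_avg r t"
  have B: "0 < ?B" using direction_bound_pos[of 0] run by simp
  have a: "0 < a" using lip_avg_bounds(1)[OF run N] by (simp add: a_def)
  have rate: "rate_const vr A f r t = ?B * sqrt (2 * ?h * a)"
    using vr unfolding rate_const_def a_def direction_bound_def Let_def by simp
  have dec: "u\<^sup>2 / (2 * ?B\<^sup>2) * (2 / a - M k / a\<^sup>2) \<le> f (X k) - f (X (Suc k))"
    if k: "k \<in> good_steps r t" for k
  proof -
    have kt: "k \<le> t" "\<not> bad_step r k" using k by (auto simp: good_steps_def)
    have Mk: "0 < M k" by (rule lip_est_bounds(1)[OF run kt(1)])
    (* The tangent of 1 / y at the average lies below 1 / y; summing it over the good steps
       compares the harmonic with the arithmetic mean. *)
    have "0 \<le> (M k - a)\<^sup>2 / (M k * a\<^sup>2)" using Mk by simp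
    also have "\<dots> = 1 / M k - (2 / a - M k / a\<^sup>2)"
      using Mk a by (simp add: field_simps power2_eq_square)
    finally have "u\<^sup>2 / (2 * ?B\<^sup>2) * (2 / a - M k / a\<^sup>2) \<le> u\<^sup>2 / (2 * ?B\<^sup>2) * (1 / M k)"
      by (intro mult_left_mono) auto
    also have "\<dots> = u\<^sup>2 / (2 * M k * ?B\<^sup>2)" by simp
    also have "\<dots> \<le> (slope k)\<^sup>2 / (2 * M k * ?B\<^sup>2)"
      using u(1) u(2)[OF kt(1)] Mk by (intro divide_right_mono power_mono) auto
    finally show ?thesis using good_step_decrease[of k] kt run vr by fastforce
  qed
  have sumM: "sum M (good_steps r t) = ?N * a" using N by (simp add: a_def lip_avg_def)
  have "(\<Sum>k\<in>good_steps r t. 2 / a - M k / a\<^sup>2) = ?N * (2 / a) - ?N * a / a\<^sup>2"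
    using sumM by (simp add: sum_subtractf num_good_def flip: sum_divide_distrib)
  also have "\<dots> = ?N / a" using a by (simp add: power2_eq_square field_simps)
  finally have "u\<^sup>2 / (2 * ?B\<^sup>2) * (?N / a)
      = (\<Sum>k\<in>good_steps r t. u\<^sup>2 / (2 * ?B\<^sup>2) * (2 / a - M k / a\<^sup>2))"
    by (simp only: sum_distrib_left[symmetric])
  also have "\<dots> \<le> (\<Sum>k\<in>good_steps r t. f (X k) - f (X (Suc k)))" by (rule sum_mono[OF dec])
  also have "\<dots> \<le> ?h" by (rule sum_decrease_le_subopt[OF run good_steps_subset(2)])
  finally have "u\<^sup>2 * ?N \<le> ?h * (2 * ?B\<^sup>2 * a)" using a B by (simp add: pos_divide_le_eq)
  then have "(u * sqrt ?N)\<^sup>2 \<le> (?B * sqrt (2 * ?h * a))\<^sup>2"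
    using a subopt_nonneg by (simp add: power_mult_distrib mult_ac)
  moreover have "0 \<le> ?B * sqrt (2 * ?h * a)" using B a subopt_nonneg by simp
  ultimately show ?thesis unfolding rate by (rule power2_le_imp_le)
qed

lemma min_gap_rate:
  assumes run: "\<forall>j\<le>t. carried_out j" and N: "1 \<le> num_good r t"
  shows "(MIN k\<in>{0..t}. G k) \<le> rate_const vr A f r t / (\<delta> * sqrt (num_good r t))"
proof -
  let ?m = "MIN k\<in>{0..t}. G k"
  have m: "?m \<le> G k" if "k \<le> t" for k using that by (intro Min_le) auto
  have "?m \<in> G ` {0..t}" by (intro Min_in) auto
  then have nn: "0 \<le> ?m" using gap_iterate_nonneg run by auto
  have "\<delta> * ?m \<le> slope k" if "k \<le> t" for k
  proof -
    have "\<delta> * ?m \<le> \<delta> * G k" using m[OF that] params by simp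
    also have "\<dots> \<le> slope k" using slope_ge_gap[of k] run that by auto
    finally show ?thesis .
  qed
  moreover have "0 \<le> \<delta> * ?m" using nn params by simp
  ultimately have "\<delta> * ?m * sqrt (num_good r t) \<le> rate_const vr A f r t"
    using fw_rate[OF _ run N] mp_rate[OF _ run N] by blast
  then show ?thesis using N params by (simp add: pos_le_divide_eq mult_ac)
qed

text \<open>The rate constant with every estimate replaced by its a priori bound: free of \<open>t\<close>, of
  \<open>\<delta>\<close> and of the run.\<close>

definition uniform_rate_const :: real where
  "uniform_rate_const = (if vr = AdaMP then radius A * sqrt (2 * subopt vr A f x0 * lip_bound)
     else max (2 * subopt vr A f x0) (lip_bound * (diameter A)\<^sup>2))"

lemma rate_const_le_uniform:
  assumes run: "\<forall>j\<le>t. carried_out j" and N: "1 \<le> num_good r t"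
  shows "rate_const vr A f r t \<le> uniform_rate_const"
proof -
  have X0: "X 0 = x0" using start by (simp add: starts_at_def)
  show ?thesis
  proof (cases "vr = AdaMP")
    case True
    have "0 \<le> radius A"
      using direction_bound_pos[of 0] run True unfolding direction_bound_def by simp
    moreover have "sqrt (2 * subopt vr A f x0 * lip_avg r t) \<le> sqrt (2 * subopt vr A f x0 * lip_bound)"
      using lip_avg_bounds(2)[OF run N] subopt_nonneg X0 by (simp add: mult_left_mono)
    ultimately show ?thesis
      using True X0 unfolding uniform_rate_const_def rate_const_def by (simp add: mult_left_mono)
  next
    case False
    have "lip_max r t * (diameter A)\<^sup>2 \<le> lip_bound * (diameter A)\<^sup>2"
      using lip_max_bounds(2)[OF run N] by (simp add: mult_right_mono)
    then show ?thesis
      using False X0 unfolding uniform_rate_const_def rate_const_def by (auto simp: Let_def)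
  qed
qed

lemma rate_order:
  assumes run: "\<forall>j\<le>t. carried_out j" and N: "1 \<le> num_good r t" and t: "1 \<le> t"
  shows "rate_const vr A f r t / (\<delta> * sqrt (num_good r t))
    \<le> uniform_rate_const * sqrt (2 * (card A ^ card A + 2)) / (\<delta> * sqrt t)"
proof -
  let ?N = "num_good r t" and ?c = "2 * (card A ^ card A + 2)"
  have "t \<le> (card A ^ card A + 2) * (?N + 1)"
    using good_fraction[of "Suc t"] run by (simp add: num_good_eq)
  also have "\<dots> \<le> (card A ^ card A + 2) * (2 * ?N)" using N by (intro mult_le_mono2) simp
  also have "\<dots> = ?c * ?N" by simp
  finally have "real t \<le> real ?c * real ?N" by (metis of_nat_le_iff of_nat_mult)
  then have "sqrt t \<le> sqrt ?c * sqrt ?N" by (metis real_sqrt_le_iff real_sqrt_mult)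
  then have le: "1 / sqrt ?N \<le> sqrt ?c / sqrt t"
    using N t by (simp add: field_simps)
  have "0 \<le> subopt vr A f x0" using subopt_nonneg start by (simp add: starts_at_def)
  have slope: "0 \<le> slope k" if "k \<le> t" for k
  proof -
    have "sound_state k" "carried_out k" using sound_states run that by auto
    then show ?thesis using iteration_sound(2) by (meson less_imp_le)
  qed
  have "0 * sqrt ?N \<le> rate_const vr A f r t"
    using fw_rate[OF _ run N order_refl slope] mp_rate[OF _ run N order_refl slope] by blast
  then have nn: "0 \<le> uniform_rate_const" using rate_const_le_uniform[OF run N] by simp
  have "rate_const vr A f r t / (\<delta> * sqrt ?N) \<le> uniform_rate_const / (\<delta> * sqrt ?N)"
    using rate_const_le_uniform[OF run N] params by (intro divide_right_mono) auto
  also have "\<dots> = uniform_rate_const / \<delta> * (1 / sqrt ?N)" by simp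
  also have "\<dots> \<le> uniform_rate_const / \<delta> * (sqrt ?c / sqrt t)"
    using le nn params by (intro mult_left_mono) auto
  finally show ?thesis by simp
qed

end

theorem theorem2:
  fixes A :: "(real ^ 'p) set"
    and f :: "real ^ 'p \<Rightarrow> real"
    and grad :: "real ^ 'p \<Rightarrow> real ^ 'p"
    and vr :: variant
    and x0 :: "real ^ 'p"
    and L Linit \<epsilon> \<tau> \<eta> :: real
  assumes "A \<noteq> {}" and "bounded A"
    and "vr = AdaPFW \<Longrightarrow> finite A"
    and "\<And>x. GDERIV f x :> grad x"
    and "L > 0" and "L-lipschitz_on (feasible_set vr A) grad"
    and "\<exists>z. is_arg_min f (\<lambda>x. x \<in> feasible_set vr A) z"
    and "x0 \<in> A" and "Linit > 0" and "\<epsilon> \<ge> 0" and "\<tau> > 1" and "0 < \<eta>" and "\<eta> \<le> 1"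
  shows
    "(\<forall>\<delta> r. 0 < \<delta> \<and> \<delta> \<le> 1 \<and> starts_at x0 r \<and>
        (\<forall>t. iteration vr A f grad Linit \<epsilon> \<tau> \<eta> \<delta> r t)
        \<longrightarrow> (\<lambda>t. gap vr A grad (iter r t)) \<longlonglongrightarrow> 0)
   \<and> (\<exists>K. \<forall>\<delta> r t. 0 < \<delta> \<and> \<delta> \<le> 1 \<and> starts_at x0 r \<and>
        (\<forall>k\<le>t. iteration vr A f grad Linit \<epsilon> \<tau> \<eta> \<delta> r k) \<and> num_good r t \<ge> 1
        \<longrightarrow> (MIN k\<in>{0..t}. gap vr A grad (iter r k))
              \<le> rate_const vr A f r t / (\<delta> * sqrt (real (num_good r t)))
          \<and> (t \<ge> 1 \<longrightarrow>
              rate_const vr A f r t / (\<delta> * sqrt (real (num_good r t)))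
                \<le> K / (\<delta> * sqrt (real t))))"
proof -
  have run: "adaptive_run A f grad vr x0 L Linit \<epsilon> \<tau> \<eta> \<delta> r"
    if "0 < \<delta>" "starts_at x0 r" for \<delta> and r :: "'p run"
    using assms that by unfold_locales auto
  obtain K where K: "\<And>\<delta> r. adaptive_run A f grad vr x0 L Linit \<epsilon> \<tau> \<eta> \<delta> r \<Longrightarrow>
      adaptive_run.uniform_rate_const A f vr x0 L Linit \<tau> * sqrt (2 * (card A ^ card A + 2)) = K"
    by blast
  show ?thesis
  proof (intro conjI exI[of _ K] allI impI)
    fix \<delta> and r :: "'p run"
    assume "0 < \<delta> \<and> \<delta> \<le> 1 \<and> starts_at x0 r \<and>
      (\<forall>t. iteration vr A f grad Linit \<epsilon> \<tau> \<eta> \<delta> r t)"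
    then show "(\<lambda>t. gap vr A grad (iter r t)) \<longlonglongrightarrow> 0"
      using adaptive_run.gap_converges[OF run] by blast
  next
    fix \<delta> and r :: "'p run" and t
    assume a: "0 < \<delta> \<and> \<delta> \<le> 1 \<and> starts_at x0 r \<and>
      (\<forall>k\<le>t. iteration vr A f grad Linit \<epsilon> \<tau> \<eta> \<delta> r k) \<and> num_good r t \<ge> 1"
    interpret adaptive_run A f grad vr x0 L Linit \<epsilon> \<tau> \<eta> \<delta> r using run a by blast
    show "(MIN k\<in>{0..t}. gap vr A grad (iter r k))
        \<le> rate_const vr A f r t / (\<delta> * sqrt (real (num_good r t)))"
      using min_gap_rate a by blast
    show "rate_const vr A f r t / (\<delta> * sqrt (real (num_good r t))) \<le> K / (\<delta> * sqrt (real t))"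
      if "t \<ge> 1"
      using rate_order[of t] a that K[OF adaptive_run_axioms] by simp
  qed
qed

end
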